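(* For all integers $1\le k\le n$, $$V_{n,k}(t)=\sum_{\sigma\in\mathcal{RS}\mathrm{II}^{(B)}_{n,n-k+1}} t^{\,n+1-2\,\mathrm{nva}(\sigma)}\quad\text{and}\quad V_{n,-k}(t)=\sum_{\sigma\in\mathcal{RS}\mathrm{II}^{(D)}_{n,-n+k-1}} t^{\,n-1-2\,\mathrm{nva}(\sigma)}.$$
   Context: The polynomials $V_{n,k}=V_{n,k}(t)$, for integers $n\ge1$ and $1\le |k|\le n$, are defined by $V_{1,1}=t^2$, $V_{1,-1}=1$, $V_{n,-n}=0$ for $n\ge 2$, and the recurrences $V_{n,-k}=V_{n,-k-1}+t^{-1}V_{n-1,k}$ for $n>k\ge 1$; $V_{n,1}=t^2\,V_{n,-1}$ for $n\ge 2$; $V_{n,k}=V_{n,k-1}+t\,V_{n-1,-k+1}$ for $n\ge k>1$. A signed permutation of $[n]=\{1,\dots,n\}$ is a bijection $\sigma$ of $\{\pm1,\dots,\pm n\}$ onto itself with $\sigma(-i)=-\sigma(i)$, written $\sigma=(\sigma_1,\dots,\sigma_n)$ with $\sigma_i=\sigma(i)$; $B_n$ is the set of these. For $1\le k\le n$, $\sigma_{[k]}$ is the subword of $\sigma$ obtained by removing all entries of absolute value greater than $k$. A double descent of a word of distinct integers is a triple of consecutive letters $a>b>c$. $\mathcal{RS}\mathrm{II}_n$ is the set of $\sigma\in B_n$ such that $\sigma_{[k]}$ contains no double descent for all $1\le k\le n$. For $\sigma\in\mathcal{RS}\mathrm{II}_n$, $\mathrm{nva}(\sigma)=\#\{i:2\le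 i\le n,\ \sigma_i<0,\ \sigma_{i-1}>\sigma_i,\ |\sigma_{i-1}|<|\sigma_i|\}$. For $1\le k\le n$, the (positive) letter $k$ is an augmenting element of $\sigma$ if $k$ is the last entry of $\sigma_{[k]}$; $\mathrm{gae}(\sigma)$ is the greatest augmenting element of $\sigma$ (taken to be $0$ if there is none). $\mathcal{RS}\mathrm{II}^{(B)}_n$ is the set of $\sigma\in\mathcal{RS}\mathrm{II}_n$ such that $\sigma_i>0$ for every $1\le i\le n$ with $|\sigma_i|=\min\{|\sigma_1|,\dots,|\sigma_i|\}$. $\mathcal{RS}\mathrm{II}^{(D)}_n$ is the set of $\sigma\in\mathcal{RS}\mathrm{II}_n$ such that $\sigma_1<0$, $|\sigma_1|>\mathrm{gae}(\sigma)$, and $\sigma_i>0$ for every $2\le i\le n$ with $|\sigma_i|=\min\{|\sigma_2|,\dots,|\sigma_i|\}$; in particular $\mathcal{RS}\mathrm{II}^{(D)}_1=\{(-1)\}$. For $1\le k\le n$, $\mathcal{RS}\mathrm{II}^{(B)}_{n,k}=\{\sigma\in\mathcal{RS}\mathrm{II}^{(B)}_n:\mathrm{gae}(\sigma)=k\}$ and $\mathcal{RS}\mathrm{II}^{(D)}_{n,-k}=\{\sigma\in\mathcal{RS}\mathrm{II}^{(D)}_n:\sigma_1=-k\}$. *)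

theory Defs
  imports
    "HOL-Computational_Algebra.Formal_Laurent_Series"
    "HOL-Combinatorics.Permutations"
begin

section \<open>The polynomials \<open>V\<close>\<close>

text \<open>
  Since \<open>t\<^sup>-\<^sup>1\<close> occurs in the recurrences, the \<open>V n k\<close> are taken in
  the ring of formal Laurent series with integer coefficients, with \<open>fls_X\<close> as the
  indeterminate \<open>t\<close> and \<open>fls_X_inv\<close> as its inverse. For indices outside
  \<open>1 \<le> \<bar>k\<bar> \<le> n\<close> the value is set to \<open>0\<close>; these values are never reached from indices
  inside the range (see \<open>V_recurrences\<close>).
\<close>

function V :: "nat \<Rightarrow> int \<Rightarrow> int fls" where
  "V n k =
    (if k = 0 \<or> \<bar>k\<bar> > int n then 0
     else if n = 1 then (if k = 1 then fls_X ^ 2 else 1)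
     else if k = - int n then 0
     else if k < 0 then V n (k - 1) + fls_X_inv * V (n - 1) (- k)
     else if k = 1 then fls_X ^ 2 * V n (- 1)
     else V n (k - 1) + fls_X * V (n - 1) (- k + 1))"
  by pat_completeness auto
termination
  by (relation "measures [\<lambda>(n, k). n, \<lambda>(n, k). nat (k + int n)]") auto

declare V.simps [simp del]

lemma V_recurrences:
  "V 1 1 = fls_X ^ 2"
  "V 1 (- 1) = 1"
  "n \<ge> 2 \<Longrightarrow> V n (- int n) = 0"
  "n > k \<Longrightarrow> k \<ge> 1 \<Longrightarrow> V n (- int k) = V n (- int k - 1) + fls_X_inv * V (n - 1) (int k)"
  "n \<ge> 2 \<Longrightarrow> V n 1 = fls_X ^ 2 * V n (- 1)"
  "n \<ge> k \<Longrightarrow> k > 1 \<Longrightarrow> V n (int k) = V n (int k - 1) + fls_X * V (n - 1) (- int k + 1)"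
  by (subst V.simps; simp)+

section \<open>Signed permutations\<close>

text \<open>
  Elements of \<open>B\<^sub>n\<close> are represented as total functions on the integers that are the identity
  outside \<open>{\<plusminus>1, \<dots>, \<plusminus>n}\<close>, so that each signed permutation has exactly one representative.
\<close>

definition signed_perms :: "nat \<Rightarrow> (int \<Rightarrow> int) set" where
  "signed_perms n =
    {\<sigma>. \<sigma> permutes ({- int n..int n} - {0}) \<and> (\<forall>i. \<sigma> (- i) = - \<sigma> i)}"

lemma finite_signed_perms: "finite (signed_perms n)"
  unfolding signed_perms_def
  by (rule finite_subset[OF _ finite_permutations[of "{- int n..int n} - {0}"]]) auto

definition word :: "nat \<Rightarrow> (int \<Rightarrow> int) \<Rightarrow> int list" where
  "word n \<sigma> = map \<sigma> [1..int n]"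

definition restricted_word :: "nat \<Rightarrow> (int \<Rightarrow> int) \<Rightarrow> nat \<Rightarrow> int list" where
  "restricted_word n \<sigma> k = filter (\<lambda>a. \<bar>a\<bar> \<le> int k) (word n \<sigma>)"

definition has_double_descent :: "int list \<Rightarrow> bool" where
  "has_double_descent w \<longleftrightarrow>
    (\<exists>i. i + 2 < length w \<and> w ! i > w ! (i + 1) \<and> w ! (i + 1) > w ! (i + 2))"

definition RSII :: "nat \<Rightarrow> (int \<Rightarrow> int) set" where
  "RSII n =
    {\<sigma> \<in> signed_perms n. \<forall>k\<in>{1..n}. \<not> has_double_descent (restricted_word n \<sigma> k)}"

definition nva :: "nat \<Rightarrow> (int \<Rightarrow> int) \<Rightarrow> nat" where
  "nva n \<sigma> =
    card {i \<in> {2..int n}. \<sigma> i < 0 \<and> \<sigma> (i - 1) > \<sigma> i \<and> \<bar>\<sigma> (i - 1)\<bar> < \<bar>\<sigma> i\<bar>}"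

definition augmenting :: "nat \<Rightarrow> (int \<Rightarrow> int) \<Rightarrow> nat \<Rightarrow> bool" where
  "augmenting n \<sigma> k \<longleftrightarrow> k \<in> {1..n} \<and> last (restricted_word n \<sigma> k) = int k"

definition gae :: "nat \<Rightarrow> (int \<Rightarrow> int) \<Rightarrow> nat" where
  "gae n \<sigma> = Max (insert 0 {k. augmenting n \<sigma> k})"

definition RSII_B :: "nat \<Rightarrow> (int \<Rightarrow> int) set" where
  "RSII_B n =
    {\<sigma> \<in> RSII n.
      \<forall>i\<in>{1..int n}. \<bar>\<sigma> i\<bar> = Min ((\<lambda>j. \<bar>\<sigma> j\<bar>) ` {1..i}) \<longrightarrow> \<sigma> i > 0}"

definition RSII_D :: "nat \<Rightarrow> (int \<Rightarrow> int) set" where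
  "RSII_D n =
    {\<sigma> \<in> RSII n.
      \<sigma> 1 < 0 \<and> \<bar>\<sigma> 1\<bar> > int (gae n \<sigma>) \<and>
      (\<forall>i\<in>{2..int n}. \<bar>\<sigma> i\<bar> = Min ((\<lambda>j. \<bar>\<sigma> j\<bar>) ` {2..i}) \<longrightarrow> \<sigma> i > 0)}"

definition RSII_B_gae :: "nat \<Rightarrow> nat \<Rightarrow> (int \<Rightarrow> int) set" where
  "RSII_B_gae n k = {\<sigma> \<in> RSII_B n. gae n \<sigma> = k}"

text \<open>The second index is the first letter itself, hence a negative integer.\<close>

definition RSII_D_first :: "nat \<Rightarrow> int \<Rightarrow> (int \<Rightarrow> int) set" where
  "RSII_D_first n k = {\<sigma> \<in> RSII_D n. \<sigma> 1 = k}"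

end

theory Submission
  imports Defs
begin

text \<open>
  A signed permutation is handled through its word. Deleting all letters of absolute value
  greater than \<open>k\<close>, for \<open>k = n - 1, n - 2, \<dots>\<close>, shows that the words counted by
  \<open>RSII_B n\<close> are exactly those that can be grown from the empty word by inserting
  \<open>\<plusminus>1, \<plusminus>2, \<dots>, \<plusminus>n\<close> one after the other, never creating a double descent and
  never putting a negative letter in front. Whether an insertion is allowed, and what it does to
  the descents, depends only on the kind of gap used. Call a descent \<open>a > b\<close> outward if
  \<open>\<bar>a\<bar> < \<bar>b\<bar>\<close> (the outward descents are those counted by \<open>nva\<close>) and inward otherwise, and
  give a word with \<open>a\<close> outward descents, \<open>b\<close> inward descents and \<open>c\<close> letters outside
  every descent the monomial \<open>u^a v^b w^c\<close>. Summed over all allowed insertions of the next letter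
  other than that of a positive last letter, the new monomials are the image of the old one under
  the derivation
    \<open>\<partial>w = u + v\<close>, \<open>\<partial>u = \<partial>v = (u + v) w\<close>,
  while appending a positive last letter multiplies by \<open>w\<close>. The letter \<open>g\<close> is the
  greatest augmenting element iff \<open>g\<close> is appended in this way and no later letter is. So if
  \<open>P\<^sub>j\<close> is the sum of the monomials of all words of size \<open>j\<close>, the words of size \<open>n\<close>
  with greatest augmenting element \<open>g\<close> contribute \<open>\<partial>^(n-g) (w P\<^sub>g\<^sub>-\<^sub>1)\<close>, and those with greatest
  augmenting element at most \<open>j\<close> contribute \<open>\<partial>^(n-j) P\<^sub>j\<close>.

  The decisive fact is that \<open>u + v - w\<^sup>2\<close> is a constant of the derivation. As
  \<open>P\<^sub>g = \<partial>P\<^sub>g\<^sub>-\<^sub>1 + w P\<^sub>g\<^sub>-\<^sub>1\<close>, it gives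
    \<open>\<partial>^(n-g) (w P\<^sub>g\<^sub>-\<^sub>1) - \<partial>^(n-g-1) (w P\<^sub>g) = (u + v - w\<^sup>2) \<partial>^(n-g-1) P\<^sub>g\<^sub>-\<^sub>1\<close>,
  and \<open>\<partial>^(n-g-1) P\<^sub>g\<^sub>-\<^sub>1\<close> collects the words of size \<open>n - 2\<close> with greatest augmenting element
  less than \<open>g\<close>. At \<open>u = t\<^sup>-\<^sup>2\<close>, \<open>v = w = 1\<close> the constant equals \<open>t\<^sup>-\<^sup>2\<close>. This is the
  recurrence for \<open>V n k\<close> with \<open>k = n - g + 1 > 1\<close>, once those words are recognised as the elements of
  \<open>RSII_D (n - 1)\<close> with first letter \<open>-g\<close>: removing the first letter \<open>-m\<close> of an element of
  \<open>RSII_D (n + 1)\<close> and closing the gap left in the absolute values is a bijection onto the words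
  of \<open>RSII_B n\<close> with greatest augmenting element less than \<open>m\<close>. The other recurrences
  follow from the same bijection and the removal of a positive last letter \<open>n\<close>.
\<close>

section \<open>Insertion into a word and its descents\<close>

definition adj :: "('a \<Rightarrow> 'a \<Rightarrow> bool) \<Rightarrow> 'a list \<Rightarrow> nat set" where
  "adj P w = {i. Suc i < length w \<and> P (w ! i) (w ! Suc i)}"

lemma adj_Nil [simp]: "adj P [] = {}"
  by (simp add: adj_def)

lemma finite_adj [simp]: "finite (adj P w)"
  by (rule finite_subset[of _ "{..<length w}"]) (auto simp: adj_def)

lemma adj_Cons:
  "adj P (x # w) = {i. i = 0 \<and> w \<noteq> [] \<and> P x (hd w)} \<union> Suc ` adj P w"
proof (rule set_eqI)
  fix i show "i \<in> adj P (x # w) \<longleftrightarrow> i \<in> {i. i = 0 \<and> w \<noteq> [] \<and> P x (hd w)} \<union> Suc ` adj P w"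
    by (cases i) (auto simp: adj_def hd_conv_nth)
qed

lemma card_adj_Cons:
  "card (adj P (x # w)) = of_bool (w \<noteq> [] \<and> P x (hd w)) + card (adj P w)"
proof -
  have "card (adj P (x # w)) = card {i::nat. i = 0 \<and> w \<noteq> [] \<and> P x (hd w)} + card (Suc ` adj P w)"
    unfolding adj_Cons by (rule card_Un_disjoint) auto
  also have "{i::nat. i = 0 \<and> w \<noteq> [] \<and> P x (hd w)} = (if w \<noteq> [] \<and> P x (hd w) then {0} else {})"
    by auto
  finally show ?thesis by (simp add: card_image)
qed

lemma card_adj_append:
  "card (adj P (u @ v)) =
     card (adj P u) + card (adj P v) + of_bool (u \<noteq> [] \<and> v \<noteq> [] \<and> P (last u) (hd v))"
  by (induction u) (auto simp: card_adj_Cons)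

lemma adj_map: "adj P (map f w) = adj (\<lambda>x y. P (f x) (f y)) w"
  by (auto simp: adj_def)

definition ins :: "nat \<Rightarrow> 'a \<Rightarrow> 'a list \<Rightarrow> 'a list" where
  "ins i m w = take i w @ m # drop i w"

lemma length_ins [simp]: "length (ins i m w) = Suc (length w)"
  by (simp add: ins_def)

lemma set_ins [simp]: "set (ins i m w) = insert m (set w)"
  by (metis append_take_drop_id ins_def list.simps(15) set_append Un_insert_right)

lemma nth_ins:
  "i \<le> length w \<Longrightarrow> j \<le> length w \<Longrightarrow>
     ins i m w ! j = (if j < i then w ! j else if j = i then m else w ! (j - 1))"
  by (auto simp: ins_def nth_append nth_Cons' min_def)

text \<open>
  The new letter separates the two letters around the gap, so the pair they formed is lost, and
  at most two new pairs arise. The lost pair stands on the left to avoid subtraction.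
\<close>

lemma card_adj_ins:
  assumes "i \<le> length w"
  shows "card (adj P (ins i m w)) + of_bool (i \<in> Suc ` adj P w) =
    card (adj P w) + of_bool (0 < i \<and> P (w ! (i - 1)) m) + of_bool (i < length w \<and> P m (w ! i))"
proof -
  have l: "last (take i w) = w ! (i - 1)" if "0 < i"
    using that assms by (cases "w = []") (auto simp: last_conv_nth min_def)
  have h: "hd (drop i w) = w ! i" if "i < length w"
    using that by (simp add: hd_drop_conv_nth)
  have S: "i \<in> Suc ` adj P w \<longleftrightarrow> 0 < i \<and> i < length w \<and> P (w ! (i - 1)) (w ! i)"
    by (cases i) (auto simp: adj_def)
  have "card (adj P w) = card (adj P (take i w @ drop i w))" by simp
  also have "\<dots> = card (adj P (take i w)) + card (adj P (drop i w)) + of_bool (i \<in> Suc ` adj P w)"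
    unfolding card_adj_append S using assms l h by (cases "w = []") auto
  finally have 1: "card (adj P w) =
    card (adj P (take i w)) + card (adj P (drop i w)) + of_bool (i \<in> Suc ` adj P w)" .
  have "card (adj P (ins i m w)) = card (adj P (take i w)) + card (adj P (drop i w))
      + of_bool (0 < i \<and> P (w ! (i - 1)) m) + of_bool (i < length w \<and> P m (w ! i))"
    unfolding ins_def card_adj_append card_adj_Cons using assms l h by (cases "w = []") auto
  with 1 show ?thesis by simp
qed

definition outward :: "int \<Rightarrow> int \<Rightarrow> bool" where
  "outward a b \<longleftrightarrow> b < a \<and> \<bar>a\<bar> < \<bar>b\<bar>"

text \<open>
  For letters of distinct absolute values this is a descent to a letter of smaller absolute
  value. With the negated form every descent is outward or inward, whatever the letters.
\<close>

definition inward :: "int \<Rightarrow> int \<Rightarrow> bool" where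
  "inward a b \<longleftrightarrow> b < a \<and> \<not> \<bar>a\<bar> < \<bar>b\<bar>"

text \<open>
  Every descent is outward or inward, so these are the positions of all descent tops, and their
  successors are the positions of all descent bottoms.
\<close>

abbreviation tops :: "int list \<Rightarrow> nat set" where
  "tops w \<equiv> adj outward w \<union> adj inward w"

lemma has_double_descent_iff: "has_double_descent w \<longleftrightarrow> tops w \<inter> Suc ` tops w \<noteq> {}"
proof
  assume "has_double_descent w"
  then obtain i where "i + 2 < length w" "w ! i > w ! (i + 1)" "w ! (i + 1) > w ! (i + 2)"
    unfolding has_double_descent_def length_ins less_Suc_eq_le by blast
  then have "i \<in> tops w" "Suc i \<in> tops w"
    by (auto simp: adj_def outward_def inward_def)
  then show "tops w \<inter> Suc ` tops w \<noteq> {}" by blast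
next
  assume "tops w \<inter> Suc ` tops w \<noteq> {}"
  then obtain i where "i \<in> tops w" "Suc i \<in> tops w" by blast
  then have "i + 2 < length w \<and> w ! i > w ! (i + 1) \<and> w ! (i + 1) > w ! (i + 2)"
    by (auto simp: adj_def outward_def inward_def)
  then show "has_double_descent w"
    unfolding has_double_descent_def by blast
qed

lemma tops_conv: "tops w = {i. Suc i < length w \<and> w ! i > w ! Suc i}"
  by (auto simp: adj_def outward_def inward_def)

text \<open>
  A large letter \<open>m\<close> is a descent top and never a descent bottom, so the only double descent
  that it can create is \<open>m > a > b\<close> with a descent \<open>a > b\<close> just behind it.
\<close>

lemma has_double_descent_ins_pos:
  assumes "i \<le> length w" "\<forall>a\<in>set w. \<bar>a\<bar> < m" "\<not> has_double_descent w"
  shows "has_double_descent (ins i m w) \<longleftrightarrow> i \<in> tops w"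
proof
  assume "has_double_descent (ins i m w)"
  then obtain j where j: "j + 2 \<le> length w" "ins i m w ! j > ins i m w ! (j + 1)"
      "ins i m w ! (j + 1) > ins i m w ! (j + 2)"
    unfolding has_double_descent_def length_ins less_Suc_eq_le by blast
  have small: "w ! l < m" if "l < length w" for l
    using assms(2) that by (meson abs_less_iff nth_mem)
  consider "j + 2 < i" | "j + 2 = i" | "j + 1 = i" | "j = i" | "j > i" by linarith
  then show "i \<in> tops w"
  proof cases
    case 1
    then have "has_double_descent w"
      using j assms(1) by (auto simp: has_double_descent_def nth_ins intro!: exI[of _ j])
    with assms(3) show ?thesis by simp
  next
    case 2 then show ?thesis using j assms(1) small[of "j+1"] by (auto simp: nth_ins)
  next
    case 3 then show ?thesis using j assms(1) small[of j] by (auto simp: nth_ins)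
  next
    case 4 then show ?thesis using j assms(1) by (auto simp: nth_ins tops_conv)
  next
    case 5
    then have "has_double_descent w"
      using j assms(1) by (auto simp: has_double_descent_def nth_ins intro!: exI[of _ "j - 1"])
    with assms(3) show ?thesis by simp
  qed
next
  assume "i \<in> tops w"
  then have i: "Suc i < length w" "w ! i > w ! Suc i" by (auto simp: tops_conv)
  moreover have "m > w ! i"
    using i assms(2) by (meson abs_less_iff nth_mem Suc_lessD)
  ultimately show "has_double_descent (ins i m w)"
    using assms(1) by (auto simp: has_double_descent_def nth_ins intro!: exI[of _ i])
qed

text \<open>
  Dually, \<open>-m\<close> can only be the last letter of a double descent. The gap is named by the letter
  before it, since \<open>-m\<close> is never put in front of the word.
\<close>

lemma has_double_descent_ins_neg:
  assumes "j < length w" "\<forall>a\<in>set w. \<bar>a\<bar> < m" "\<not> has_double_descent w"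
  shows "has_double_descent (ins (Suc j) (- m) w) \<longleftrightarrow> j \<in> Suc ` tops w"
proof
  assume "has_double_descent (ins (Suc j) (- m) w)"
  then obtain l where l: "l + 2 \<le> length w"
      "ins (Suc j) (- m) w ! l > ins (Suc j) (- m) w ! (l + 1)"
      "ins (Suc j) (- m) w ! (l + 1) > ins (Suc j) (- m) w ! (l + 2)"
    unfolding has_double_descent_def length_ins less_Suc_eq_le by blast
  have small: "- m < w ! l" if "l < length w" for l
    using assms(2) that by (meson abs_less_iff nth_mem minus_less_iff)
  consider "l + 1 < j" | "l + 1 = j" | "l = j" | "l = j + 1" | "l > j + 1" by linarith
  then show "j \<in> Suc ` tops w"
  proof cases
    case 1
    then have "has_double_descent w"
      using l assms(1) by (auto simp: has_double_descent_def nth_ins intro!: exI[of _ l])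
    with assms(3) show ?thesis by simp
  next
    case 2 then show ?thesis using l assms(1) by (auto simp: nth_ins tops_conv)
  next
    case 3 then show ?thesis using l assms(1) small[of "l+1"] by (auto simp: nth_ins)
  next
    case 4 then show ?thesis using l assms(1) small[of l] by (auto simp: nth_ins)
  next
    case 5
    then have "has_double_descent w"
      using l assms(1) by (auto simp: has_double_descent_def nth_ins intro!: exI[of _ "l - 1"])
    with assms(3) show ?thesis by simp
  qed
next
  assume "j \<in> Suc ` tops w"
  then obtain i where i: "j = Suc i" "Suc i < length w" "w ! i > w ! Suc i"
    by (auto simp: tops_conv)
  moreover have "- m < w ! Suc i"
    using i assms(2) by (meson abs_less_iff nth_mem minus_less_iff)
  ultimately show "has_double_descent (ins (Suc j) (- m) w)"
    using assms(1) by (auto simp: has_double_descent_def nth_ins intro!: exI[of _ i])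
qed

section \<open>Words of signed permutations\<close>

definition restr :: "nat \<Rightarrow> int list \<Rightarrow> int list" where
  "restr k w = filter (\<lambda>a. \<bar>a\<bar> \<le> int k) w"

definition signed_words :: "nat \<Rightarrow> int list set" where
  "signed_words n = {w. distinct (map abs w) \<and> abs ` set w = {1..int n}}"

text \<open>
  Requiring a positive first letter of every restriction amounts to requiring that all
  left-to-right minima of the absolute values are positive, because these minima are the first
  letters of the restrictions. Unlike the condition on minima, it can be checked one insertion at
  a time.
\<close>

definition admissible :: "int list \<Rightarrow> bool" where
  "admissible u \<longleftrightarrow> \<not> has_double_descent u \<and> (u \<noteq> [] \<longrightarrow> 0 < hd u)"

definition simsun_words :: "nat \<Rightarrow> int list set" where
  "simsun_words n = {w \<in> signed_words n. \<forall>k. admissible (restr k w)}"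

definition word_gae :: "nat \<Rightarrow> int list \<Rightarrow> nat" where
  "word_gae n w = Max (insert 0 {k \<in> {1..n}. last (restr k w) = int k})"

lemma length_signed_words: "w \<in> signed_words n \<Longrightarrow> length w = n"
  using distinct_card[of "map abs w"] by (simp add: signed_words_def)

lemma abs_in_signed_words: "w \<in> signed_words n \<Longrightarrow> a \<in> set w \<Longrightarrow> 1 \<le> \<bar>a\<bar> \<and> \<bar>a\<bar> \<le> int n"
  unfolding signed_words_def by (metis (mono_tags, lifting) atLeastAtMost_iff image_eqI mem_Collect_eq)

lemma finite_signed_words: "finite (signed_words n)"
proof (rule finite_subset)
  show "signed_words n \<subseteq> {w. set w \<subseteq> {- int n..int n} \<and> length w = n}"
    using length_signed_words abs_in_signed_words by (auto simp: abs_le_iff) (smt (verit))+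
  show "finite {w. set w \<subseteq> {- int n..int n} \<and> length w = n}"
    by (rule finite_lists_length_eq) simp
qed

lemma finite_simsun_words: "finite (simsun_words n)"
  unfolding simsun_words_def using finite_signed_words by simp

lemma restr_all: "w \<in> signed_words n \<Longrightarrow> n \<le> k \<Longrightarrow> restr k w = w"
  unfolding restr_def by (rule filter_True) (fastforce dest: abs_in_signed_words)

lemma restr_ins: "k < nat \<bar>m\<bar> \<Longrightarrow> restr k (ins i m w) = restr k w"
  by (metis (no_types, lifting) append_take_drop_id filter.simps(2) filter_append ins_def
      not_le restr_def zless_nat_eq_int_zless)

lemma signed_words_ins:
  assumes "w \<in> signed_words n" "\<bar>m\<bar> = int (Suc n)"
  shows "ins i m w \<in> signed_words (Suc n)"
proof -
  have "\<bar>m\<bar> \<notin> abs ` set w" using assms by (auto simp: signed_words_def)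
  moreover have "distinct (map abs (take i w) @ map abs (drop i w))"
    using assms by (simp add: signed_words_def flip: map_append)
  ultimately have "distinct (map abs (ins i m w))"
    by (auto simp: ins_def dest!: in_set_takeD in_set_dropD)
  moreover have "abs ` set (ins i m w) = insert (int (Suc n)) {1..int n}"
    using assms by (simp add: signed_words_def)
  moreover have "insert (int (Suc n)) {1..int n} = {1..int (Suc n)}" by auto
  ultimately show ?thesis unfolding signed_words_def by simp
qed

lemma signed_words_SucE:
  assumes "w \<in> signed_words (Suc n)"
  obtains u i m where "u \<in> signed_words n" "i \<le> n" "\<bar>m\<bar> = int (Suc n)" "w = ins i m u"
proof -
  have "int (Suc n) \<in> abs ` set w" using assms by (auto simp: signed_words_def)
  then obtain m where m: "m \<in> set w" "\<bar>m\<bar> = int (Suc n)" by auto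
  then obtain p q where w: "w = p @ m # q" by (meson split_list)
  have "distinct (map abs (p @ q))" and new: "\<bar>m\<bar> \<notin> abs ` set (p @ q)"
    and im: "insert \<bar>m\<bar> (abs ` set (p @ q)) = {1..int (Suc n)}"
    using assms by (auto simp: signed_words_def w)
  moreover have "abs ` set (p @ q) = {1..int n}"
  proof -
    have "abs ` set (p @ q) = {1..int (Suc n)} - {\<bar>m\<bar>}" using new im by blast
    then show ?thesis using m by auto
  qed
  ultimately have u: "p @ q \<in> signed_words n" by (simp add: signed_words_def)
  then have "length p \<le> n" using length_signed_words by fastforce
  moreover have "w = ins (length p) m (p @ q)" by (simp add: w ins_def)
  ultimately show ?thesis using that u m by blast
qed

text \<open>
  The inserted letter is the one of largest absolute value, so the gap can be read off as the
  number of smaller letters before it.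
\<close>

lemma ins_inject:
  assumes "u \<in> signed_words n" "u' \<in> signed_words n" "i \<le> n" "i' \<le> n"
    and "\<bar>m\<bar> = int (Suc n)" "\<bar>m'\<bar> = int (Suc n)" "ins i m u = ins i' m' u'"
  shows "u = u' \<and> i = i' \<and> m = m'"
proof -
  have u: "restr n (ins j x v) = v" if "v \<in> signed_words n" "\<bar>x\<bar> = int (Suc n)" for j x v
    using that by (simp add: restr_ins restr_all)
  have len: "length (takeWhile (\<lambda>a. \<bar>a\<bar> \<le> int n) (ins j x v)) = j"
    if "v \<in> signed_words n" "\<bar>x\<bar> = int (Suc n)" "j \<le> n" for j x v
  proof -
    have "\<forall>a\<in>set (take j v). \<bar>a\<bar> \<le> int n"
      using that abs_in_signed_words by (meson in_set_takeD)
    then have "takeWhile (\<lambda>a. \<bar>a\<bar> \<le> int n) (take j v @ x # drop j v) = take j v"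
      using that(2) by (subst takeWhile_append2) auto
    then show ?thesis using that length_signed_words unfolding ins_def by fastforce
  qed
  have "u = u'" using u assms by metis
  moreover have "i = i'" using len assms by metis
  moreover have "ins j x v ! j = x" if "v \<in> signed_words n" "j \<le> n" for j v and x :: int
    using that length_signed_words by (simp add: nth_ins)
  ultimately show ?thesis using assms by metis
qed

lemma simsun_words_ins_iff:
  assumes "u \<in> signed_words n" "\<bar>m\<bar> = int (Suc n)"
  shows "ins i m u \<in> simsun_words (Suc n) \<longleftrightarrow> u \<in> simsun_words n \<and> admissible (ins i m u)"
proof -
  have w: "ins i m u \<in> signed_words (Suc n)" using assms by (rule signed_words_ins)
  have small: "restr k (ins i m u) = restr k u" if "k \<le> n" for k
    using that assms by (intro restr_ins) auto
  have big: "restr k (ins i m u) = ins i m u" if "Suc n \<le> k" for k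
    using w that by (rule restr_all)
  have big': "restr k u = restr n u" if "n \<le> k" for k
    using assms(1) that by (simp add: restr_all)
  have "(\<forall>k. admissible (restr k (ins i m u))) \<longleftrightarrow>
    (\<forall>k\<le>n. admissible (restr k u)) \<and> admissible (ins i m u)"
    using small big by (metis not_less_eq_eq order_refl)
  moreover have "(\<forall>k\<le>n. admissible (restr k u)) \<longleftrightarrow> (\<forall>k. admissible (restr k u))"
    using big' by (metis nle_le)
  ultimately show ?thesis using assms(1) w by (simp add: simsun_words_def)
qed

lemma admissible_simsun: "w \<in> simsun_words n \<Longrightarrow> admissible w"
  by (metis (no_types, lifting) mem_Collect_eq order_refl restr_all simsun_words_def)

lemma hd_ins: "i \<le> length w \<Longrightarrow> hd (ins i m w) = (if i = 0 then m else hd w)"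
  by (cases w; cases i) (auto simp: ins_def)

lemma last_ins: "i \<le> length w \<Longrightarrow> last (ins i m w) = (if i = length w then m else last w)"
  by (auto simp: ins_def)

lemma simsun_words_ins_pos:
  assumes "u \<in> simsun_words n" "i \<le> n"
  shows "ins i (int (Suc n)) u \<in> simsun_words (Suc n) \<longleftrightarrow> i \<notin> tops u"
proof -
  have u: "u \<in> signed_words n"
    using assms(1) by (simp add: simsun_words_def)
  have adm: "admissible u" using assms(1) by (rule admissible_simsun)
  have small: "\<forall>a\<in>set u. \<bar>a\<bar> < int (Suc n)" using abs_in_signed_words[OF u] by fastforce
  have len: "length u = n" using u by (rule length_signed_words)
  have "has_double_descent (ins i (int (Suc n)) u) \<longleftrightarrow> i \<in> tops u"
    using adm assms(2) len small
    by (intro has_double_descent_ins_pos) (auto simp: admissible_def)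
  moreover have "hd (ins i (int (Suc n)) u) > 0"
    using adm assms(2) len by (auto simp: hd_ins admissible_def)
  moreover have "ins i (int (Suc n)) u \<noteq> []" by (simp add: ins_def)
  ultimately show ?thesis
    using simsun_words_ins_iff[OF u, of "int (Suc n)" i] assms(1) by (simp add: admissible_def)
qed

lemma simsun_words_ins_neg:
  assumes "u \<in> simsun_words n" "j < n"
  shows "ins (Suc j) (- int (Suc n)) u \<in> simsun_words (Suc n) \<longleftrightarrow> j \<notin> Suc ` tops u"
proof -
  have u: "u \<in> signed_words n"
    using assms(1) by (simp add: simsun_words_def)
  have adm: "admissible u" using assms(1) by (rule admissible_simsun)
  have small: "\<forall>a\<in>set u. \<bar>a\<bar> < int (Suc n)" using abs_in_signed_words[OF u] by fastforce
  have len: "length u = n" using u by (rule length_signed_words)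
  have "has_double_descent (ins (Suc j) (- int (Suc n)) u) \<longleftrightarrow> j \<in> Suc ` tops u"
    using adm assms(2) len small
    by (intro has_double_descent_ins_neg) (auto simp: admissible_def)
  moreover have "hd (ins (Suc j) (- int (Suc n)) u) > 0"
    using adm assms(2) len by (auto simp: hd_ins admissible_def)
  moreover have "ins (Suc j) (- int (Suc n)) u \<noteq> []" by (simp add: ins_def)
  ultimately show ?thesis
    using simsun_words_ins_iff[OF u, of "- int (Suc n)" "Suc j"] assms(1)
    by (simp add: admissible_def)
qed

lemma not_simsun_words_ins_0_neg: "ins 0 (- int (Suc n)) u \<notin> simsun_words (Suc n)"
  using admissible_simsun by (fastforce simp: ins_def admissible_def)

lemma word_gae_ins:
  assumes "u \<in> signed_words n" "i \<le> n" "\<bar>m\<bar> = int (Suc n)"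
  shows "word_gae (Suc n) (ins i m u) = (if i = n \<and> m = int (Suc n) then Suc n else word_gae n u)"
proof -
  have len: "length u = n" using assms(1) by (rule length_signed_words)
  have small: "restr k (ins i m u) = restr k u" if "k \<le> n" for k
    using that assms by (intro restr_ins) auto
  have big: "restr (Suc n) (ins i m u) = ins i m u"
    using signed_words_ins[OF assms(1,3)] by (rule restr_all) simp
  have last: "last (ins i m u) = int (Suc n) \<longleftrightarrow> i = n \<and> m = int (Suc n)"
  proof (cases "i = n")
    case False
    then have "last u \<in> set u" using assms(2) len by (intro last_in_set) auto
    then show ?thesis using False abs_in_signed_words[OF assms(1)] assms(2) len
      by (force simp: last_ins)
  qed (auto simp: last_ins len)
  let ?A = "{k \<in> {1..n}. last (restr k u) = int k}"
  have "{k \<in> {1..Suc n}. last (restr k (ins i m u)) = int k} =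
      ?A \<union> {k. k = Suc n \<and> i = n \<and> m = int (Suc n)}"
    using small big last by (auto simp: le_Suc_eq)
  moreover have "Max (insert 0 (insert (Suc n) ?A)) = Suc n"
    by (rule Max_eqI) auto
  ultimately show ?thesis unfolding word_gae_def by auto
qed

lemma word_gae_le: "word_gae n w \<le> n"
  unfolding word_gae_def by (subst Max_le_iff) auto

lemma word_gae_less_iff:
  assumes "0 < m"
  shows "word_gae n w < m \<longleftrightarrow> (\<forall>k\<in>{m..n}. last (restr k w) \<noteq> int k)"
  unfolding word_gae_def using assms
  by (subst Max_less_iff) (auto, metis Suc_leI leD less_le_trans)

section \<open>The effect of one insertion\<close>

type_synonym 'a weighting = "nat \<Rightarrow> nat \<Rightarrow> nat \<Rightarrow> 'a"

text \<open>
  A weighting assigns a value to the monomial \<open>u^a v^b w^c\<close>, so it stands for a linear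
  functional on polynomials in \<open>u\<close>, \<open>v\<close>, \<open>w\<close>; a functional is used in place of the
  polynomials because all that matters about them in the end is the value at one point. Without
  double descents every letter belongs to at most one descent, hence
  \<open>c = length w - 2 * (a + b)\<close> letters lie outside every descent.
\<close>

definition weight :: "'a weighting \<Rightarrow> int list \<Rightarrow> 'a" where
  "weight \<phi> w =
    (let a = card (adj outward w); b = card (adj inward w) in \<phi> a b (length w - 2 * (a + b)))"

text \<open>
  The weighting \<open>insert_op \<phi>\<close> is \<open>\<phi>\<close> applied to the derivative of the monomial under
  \<open>\<partial>w = u + v\<close>, \<open>\<partial>u = \<partial>v = (u + v) w\<close>, and \<open>append_op \<phi>\<close> is \<open>\<phi>\<close> applied to
  \<open>w\<close> times the monomial. The truncated differences \<open>a - 1\<close>, \<open>b - 1\<close>, \<open>c - 1\<close> at \<open>0\<close>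
  are harmless, as their coefficients then vanish.
\<close>

definition insert_op :: "'a::comm_ring_1 weighting \<Rightarrow> 'a weighting" where
  "insert_op \<phi> a b c =
     of_nat a * (\<phi> (a - 1) (b + 1) (c + 1) + \<phi> a b (c + 1)) +
     of_nat b * (\<phi> a b (c + 1) + \<phi> (a + 1) (b - 1) (c + 1)) +
     of_nat c * (\<phi> a (b + 1) (c - 1) + \<phi> (a + 1) b (c - 1))"

definition append_op :: "'a weighting \<Rightarrow> 'a weighting" where
  "append_op \<phi> a b c = \<phi> a b (c + 1)"

lemma tops_less: "tops w \<subseteq> {..<length w}" "Suc ` tops w \<subseteq> {..<length w}"
  by (auto simp: adj_def)

lemma adj_outward_inward_disjoint: "adj outward w \<inter> adj inward w = {}"
  by (auto simp: adj_def outward_def inward_def)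

lemma card_tops: "card (tops w) = card (adj outward w) + card (adj inward w)"
  using adj_outward_inward_disjoint by (intro card_Un_disjoint) auto

lemma card_tops_le:
  assumes "\<not> has_double_descent w"
  shows "2 * (card (adj outward w) + card (adj inward w)) \<le> length w"
proof -
  have "card (tops w) + card (Suc ` tops w) = card (tops w \<union> Suc ` tops w)"
    using assms unfolding has_double_descent_iff by (intro card_Un_disjoint[symmetric]) auto
  also have "\<dots> \<le> card {..<length w}"
    using tops_less[of w] by (intro card_mono) auto
  finally show ?thesis by (simp add: card_image card_tops)
qed

text \<open>
  This sums over the allowed gaps: \<open>X\<close> are the forbidden ones, \<open>S\<close> and \<open>T\<close> those
  inside an outward and an inward descent, respectively. In a word without double descents there
  are as many forbidden gaps as descents.
\<close>

lemma sum_outside: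
  fixes p q r :: "'a::comm_ring_1"
  assumes "X \<subseteq> {..<n}" "S \<subseteq> {..<n}" "T \<subseteq> {..<n}"
    and "X \<inter> S = {}" "X \<inter> T = {}" "S \<inter> T = {}" "card X = card S + card T"
  shows "(\<Sum>i\<in>{..<n} - X. if i \<in> S then p else if i \<in> T then q else r) =
    of_nat (card S) * p + of_nat (card T) * q + of_nat (n - 2 * (card S + card T)) * r"
proof -
  let ?R = "{..<n} - (X \<union> S \<union> T)" and ?f = "\<lambda>i. if i \<in> S then p else if i \<in> T then q else r"
  have fin: "finite X" "finite S" "finite T" using assms(1-3) finite_subset by blast+
  have "card (X \<union> S \<union> T) = 2 * (card S + card T)"
    using fin assms(4-7) by (simp add: card_Un_disjoint Int_Un_distrib2)
  then have R: "card ?R = n - 2 * (card S + card T)"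
    using fin assms(1-3) by (subst card_Diff_subset) auto
  have "{..<n} - X = S \<union> (T \<union> ?R)" using assms by blast
  moreover have "sum ?f (S \<union> (T \<union> ?R)) = sum ?f S + (sum ?f T + sum ?f ?R)"
    using fin assms(6) by (subst sum.union_disjoint; (subst sum.union_disjoint)?) auto
  moreover have "sum ?f S = of_nat (card S) * p" by simp
  moreover have "sum ?f T = (\<Sum>i\<in>T. q)" using assms(6) by (intro sum.cong) auto
  moreover have "sum ?f ?R = (\<Sum>i\<in>?R. r)" by (intro sum.cong) auto
  ultimately show ?thesis using R by simp
qed

text \<open>
  A large letter \<open>m\<close> in front of \<open>y\<close> makes \<open>m > y\<close> an inward descent; if the gap was inside
  a descent \<open>x > y\<close>, this new descent replaces the old one.
\<close>

lemma weight_ins_pos: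
  assumes small: "\<forall>a\<in>set w. \<bar>a\<bar> < m" and dd: "\<not> has_double_descent w"
    and i: "i < length w" "i \<notin> tops w"
    and abc: "a = card (adj outward w)" "b = card (adj inward w)" "c = length w - 2 * (a + b)"
  shows "weight \<phi> (ins i m w) =
    (if i \<in> Suc ` adj outward w then \<phi> (a - 1) (b + 1) (c + 1)
     else if i \<in> Suc ` adj inward w then \<phi> a b (c + 1) else \<phi> a (b + 1) (c - 1))"
proof -
  have "\<bar>w ! i\<bar> < m" "\<bar>w ! (i - 1)\<bar> < m" using small i(1) by simp_all
  then have pairs: "\<not> outward (w ! (i - 1)) m" "\<not> outward m (w ! i)"
      "\<not> inward (w ! (i - 1)) m" "inward m (w ! i)"
    unfolding outward_def inward_def by linarith+
  have out: "card (adj outward (ins i m w)) + of_bool (i \<in> Suc ` adj outward w) = a"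
    using card_adj_ins[of i w outward m] i(1) pairs abc(1) by simp
  have inw: "card (adj inward (ins i m w)) + of_bool (i \<in> Suc ` adj inward w) = b + 1"
    using card_adj_ins[of i w inward m] i(1) pairs abc(2) by simp
  have "\<not> (i \<in> Suc ` adj outward w \<and> i \<in> Suc ` adj inward w)"
    using adj_outward_inward_disjoint[of w] by blast
  then consider "i \<in> Suc ` adj outward w" "i \<notin> Suc ` adj inward w"
    | "i \<notin> Suc ` adj outward w" "i \<in> Suc ` adj inward w"
    | "i \<notin> Suc ` adj outward w" "i \<notin> Suc ` adj inward w" by blast
  moreover have "2 * (a + b) \<le> length w" using card_tops_le[OF dd] abc by simp
  ultimately show ?thesis
  proof cases
    case 1
    then have "card (adj outward (ins i m w)) = a - 1" "card (adj inward (ins i m w)) = b + 1" "0 < a"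
      using out inw by simp_all
    moreover have "Suc (length w) - 2 * (a - 1 + (b + 1)) = c + 1"
      using abc(3) \<open>0 < a\<close> \<open>2 * (a + b) \<le> length w\<close> by simp
    ultimately show ?thesis using 1 by (simp only: weight_def Let_def length_ins if_True)
  next
    case 2
    then have "card (adj outward (ins i m w)) = a" "card (adj inward (ins i m w)) = b"
      using out inw by simp_all
    moreover have "Suc (length w) - 2 * (a + b) = c + 1"
      using abc(3) \<open>2 * (a + b) \<le> length w\<close> by simp
    ultimately show ?thesis using 2 by (simp only: weight_def Let_def length_ins if_True if_False)
  next
    case 3
    then have "card (adj outward (ins i m w)) = a" "card (adj inward (ins i m w)) = b + 1"
      using out inw by simp_all
    moreover have "Suc (length w) - 2 * (a + (b + 1)) = c - 1"
      using abc(3) by simp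
    ultimately show ?thesis using 3 by (simp only: weight_def Let_def length_ins if_False)
  qed
qed

text \<open>
  Behind a letter \<open>x\<close>, the letter \<open>-m\<close> makes \<open>x > -m\<close> an outward descent; if the gap was
  inside a descent \<open>x > y\<close>, this new descent replaces the old one.
\<close>

lemma weight_ins_neg:
  assumes small: "\<forall>a\<in>set w. \<bar>a\<bar> < m" and dd: "\<not> has_double_descent w"
    and j: "j < length w" "j \<notin> Suc ` tops w"
    and abc: "a = card (adj outward w)" "b = card (adj inward w)" "c = length w - 2 * (a + b)"
  shows "weight \<phi> (ins (Suc j) (- m) w) =
    (if j \<in> adj outward w then \<phi> a b (c + 1)
     else if j \<in> adj inward w then \<phi> (a + 1) (b - 1) (c + 1) else \<phi> (a + 1) b (c - 1))"
proof -
  have "\<bar>w ! j\<bar> < m" using small j(1) by simp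
  then have p1: "outward (w ! j) (- m)" "\<not> inward (w ! j) (- m)"
    unfolding outward_def inward_def by linarith+
  have p2: "\<not> (Suc j < length w \<and> outward (- m) (w ! Suc j))"
      "\<not> (Suc j < length w \<and> inward (- m) (w ! Suc j))"
    using small unfolding outward_def inward_def by (metis abs_less_iff minus_less_iff nth_mem order_less_asym)+
  have out: "card (adj outward (ins (Suc j) (- m) w)) + of_bool (j \<in> adj outward w) = a + 1"
    using card_adj_ins[of "Suc j" w outward "- m"] j(1) p1 p2 abc(1)
    by (simp add: inj_image_mem_iff del: of_bool_eq_0_iff)
  have inw: "card (adj inward (ins (Suc j) (- m) w)) + of_bool (j \<in> adj inward w) = b"
    using card_adj_ins[of "Suc j" w inward "- m"] j(1) p1 p2 abc(2)
    by (simp add: inj_image_mem_iff)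
  consider "j \<in> adj outward w" "j \<notin> adj inward w"
    | "j \<notin> adj outward w" "j \<in> adj inward w"
    | "j \<notin> adj outward w" "j \<notin> adj inward w"
    using adj_outward_inward_disjoint[of w] by blast
  moreover have "2 * (a + b) \<le> length w" using card_tops_le[OF dd] abc by simp
  ultimately show ?thesis
  proof cases
    case 1
    then have "card (adj outward (ins (Suc j) (- m) w)) = a" "card (adj inward (ins (Suc j) (- m) w)) = b"
      using out inw by simp_all
    moreover have "Suc (length w) - 2 * (a + b) = c + 1"
      using abc(3) \<open>2 * (a + b) \<le> length w\<close> by simp
    ultimately show ?thesis using 1 by (simp only: weight_def Let_def length_ins if_True)
  next
    case 2
    then have "card (adj outward (ins (Suc j) (- m) w)) = a + 1"
        "card (adj inward (ins (Suc j) (- m) w)) = b - 1" "0 < b"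
      using out inw by simp_all
    moreover have "Suc (length w) - 2 * (a + 1 + (b - 1)) = c + 1"
      using abc(3) \<open>0 < b\<close> \<open>2 * (a + b) \<le> length w\<close> by simp
    ultimately show ?thesis using 2 by (simp only: weight_def Let_def length_ins if_True if_False)
  next
    case 3
    then have "card (adj outward (ins (Suc j) (- m) w)) = a + 1" "card (adj inward (ins (Suc j) (- m) w)) = b"
      using out inw by simp_all
    moreover have "Suc (length w) - 2 * (a + 1 + b) = c - 1"
      using abc(3) by simp
    ultimately show ?thesis using 3 by (simp only: weight_def Let_def length_ins if_False)
  qed
qed

lemma weight_ins_end:
  assumes small: "\<forall>a\<in>set w. \<bar>a\<bar> < m" and dd: "\<not> has_double_descent w"
  shows "weight \<phi> (ins (length w) m w) = weight (append_op \<phi>) w"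
proof -
  have no: "length w \<notin> Suc ` adj P w" for P by (auto simp: adj_def)
  have "\<not> outward (w ! (length w - 1)) m \<and> \<not> inward (w ! (length w - 1)) m" if "0 < length w"
  proof -
    have "\<bar>w ! (length w - 1)\<bar> < m" using small that by simp
    then show ?thesis unfolding outward_def inward_def by linarith
  qed
  then have "card (adj outward (ins (length w) m w)) = card (adj outward w)"
      "card (adj inward (ins (length w) m w)) = card (adj inward w)"
    using card_adj_ins[of "length w" w outward m] card_adj_ins[of "length w" w inward m]
    by (auto simp: no)
  then show ?thesis
    using card_tops_le[OF dd] by (simp add: weight_def append_op_def Suc_diff_le)
qed

lemma sum_weight_ins:
  fixes \<phi> :: "'a::comm_ring_1 weighting"
  assumes small: "\<forall>a\<in>set w. \<bar>a\<bar> < m" and dd: "\<not> has_double_descent w"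
  shows "(\<Sum>i\<in>{..<length w} - tops w. weight \<phi> (ins i m w)) +
      (\<Sum>j\<in>{..<length w} - Suc ` tops w. weight \<phi> (ins (Suc j) (- m) w)) = weight (insert_op \<phi>) w"
proof -
  define a b c where abc: "a = card (adj outward w)" "b = card (adj inward w)"
    "c = length w - 2 * (a + b)"
  have disj: "tops w \<inter> Suc ` tops w = {}" using dd by (simp add: has_double_descent_iff)
  have tops: "card (tops w) = a + b" "card (Suc ` tops w) = a + b"
    by (simp_all add: card_image card_tops abc)
  have "(\<Sum>i\<in>{..<length w} - tops w. weight \<phi> (ins i m w)) =
    (\<Sum>i\<in>{..<length w} - tops w. if i \<in> Suc ` adj outward w then \<phi> (a - 1) (b + 1) (c + 1)
     else if i \<in> Suc ` adj inward w then \<phi> a b (c + 1) else \<phi> a (b + 1) (c - 1))"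
    by (intro sum.cong refl weight_ins_pos[OF small dd _ _ abc]) auto
  also have "\<dots> = of_nat (card (Suc ` adj outward w)) * \<phi> (a - 1) (b + 1) (c + 1) +
     of_nat (card (Suc ` adj inward w)) * \<phi> a b (c + 1) +
     of_nat (length w - 2 * (card (Suc ` adj outward w) + card (Suc ` adj inward w))) * \<phi> a (b + 1) (c - 1)"
    using tops_less[of w] disj adj_outward_inward_disjoint[of w] tops
    by (intro sum_outside) (auto simp: card_image abc)
  finally have 1: "(\<Sum>i\<in>{..<length w} - tops w. weight \<phi> (ins i m w)) =
    of_nat a * \<phi> (a - 1) (b + 1) (c + 1) + of_nat b * \<phi> a b (c + 1) + of_nat c * \<phi> a (b + 1) (c - 1)"
    by (simp add: card_image abc)
  have "(\<Sum>j\<in>{..<length w} - Suc ` tops w. weight \<phi> (ins (Suc j) (- m) w)) =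
    (\<Sum>j\<in>{..<length w} - Suc ` tops w. if j \<in> adj outward w then \<phi> a b (c + 1)
     else if j \<in> adj inward w then \<phi> (a + 1) (b - 1) (c + 1) else \<phi> (a + 1) b (c - 1))"
    by (intro sum.cong refl weight_ins_neg[OF small dd _ _ abc]) auto
  also have "\<dots> = of_nat (card (adj outward w)) * \<phi> a b (c + 1) +
     of_nat (card (adj inward w)) * \<phi> (a + 1) (b - 1) (c + 1) +
     of_nat (length w - 2 * (card (adj outward w) + card (adj inward w))) * \<phi> (a + 1) b (c - 1)"
    using tops_less[of w] disj adj_outward_inward_disjoint[of w] tops
    by (intro sum_outside) (auto simp: abc)
  finally have 2: "(\<Sum>j\<in>{..<length w} - Suc ` tops w. weight \<phi> (ins (Suc j) (- m) w)) =
    of_nat a * \<phi> a b (c + 1) + of_nat b * \<phi> (a + 1) (b - 1) (c + 1) + of_nat c * \<phi> (a + 1) b (c - 1)"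
    by (simp add: abc)
  have "weight (insert_op \<phi>) w = insert_op \<phi> a b c" by (simp add: weight_def Let_def abc)
  then show ?thesis unfolding 1 2 insert_op_def by (simp only: algebra_simps)
qed

section \<open>Recurrences for the sums over words\<close>

definition simsun_sum :: "nat \<Rightarrow> (nat \<Rightarrow> bool) \<Rightarrow> 'a::comm_ring_1 weighting \<Rightarrow> 'a" where
  "simsun_sum n Q \<phi> = (\<Sum>w\<in>{w \<in> simsun_words n. Q (word_gae n w)}. weight \<phi> w)"

lemma simsun_signed: "w \<in> simsun_words n \<Longrightarrow> w \<in> signed_words n"
  by (simp add: simsun_words_def)

text \<open>
  The words of size \<open>n + 1\<close> arise from those of size \<open>n\<close> by inserting \<open>\<plusminus>(n + 1)\<close>. A positive
  last letter makes \<open>n + 1\<close> the greatest augmenting element, and every other insertion leaves the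
  greatest augmenting element unchanged.
\<close>

lemma simsun_sum_Suc:
  "simsun_sum (Suc n) Q \<phi> =
     simsun_sum n Q (insert_op \<phi>) + (if Q (Suc n) then simsun_sum n (\<lambda>_. True) (append_op \<phi>) else 0)"
proof -
  let ?M = "int (Suc n)"
  \<comment> \<open>\<open>p\<close> inserts \<open>n + 1\<close> before letter \<open>i\<close>, \<open>q\<close> inserts \<open>-(n + 1)\<close> behind letter \<open>j\<close>, \<open>e\<close> appends \<open>n + 1\<close>.\<close>
  define S where "S = {u \<in> simsun_words n. Q (word_gae n u)}"
  define I J where "I = Sigma S (\<lambda>u. {..<n} - tops u)" and "J = Sigma S (\<lambda>u. {..<n} - Suc ` tops u)"
  define p q e where "p = (\<lambda>(u, i). ins i ?M u)" and "q = (\<lambda>(u, j). ins (Suc j) (- ?M) u)"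
    and "e = (\<lambda>u. ins n ?M u)"
  define E where "E = (if Q (Suc n) then simsun_words n else {})"
  have S: "u \<in> signed_words n" "u \<in> simsun_words n" "length u = n" if "u \<in> S" for u
    using that length_signed_words by (auto simp: S_def simsun_signed)
  have fin: "finite S" "finite I" "finite J" "finite E"
    unfolding I_def J_def E_def S_def using finite_simsun_words by auto
  have inj: "u = u' \<and> i = i' \<and> m = m'" if "ins i m u = ins i' m' u'" "u \<in> signed_words n"
    "u' \<in> signed_words n" "i \<le> n" "i' \<le> n" "m \<in> {?M, - ?M}" "m' \<in> {?M, - ?M}" for u u' i i' m m'
    using ins_inject[of u n u' i i' m m'] that by auto
  have inj_p: "inj_on p I"
    by (rule inj_onI) (auto simp: p_def I_def simp del: of_nat_Suc dest!: S(1) dest: inj)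
  have inj_q: "inj_on q J"
    by (rule inj_onI) (auto simp: q_def J_def simp del: of_nat_Suc dest!: S(1) dest: inj)
  have inj_e: "inj_on e E"
    by (rule inj_onI) (auto simp: e_def E_def simp del: of_nat_Suc split: if_splits dest!: simsun_signed dest: inj)
  have pq: "p ` I \<inter> q ` J = {}"
    by (auto simp: p_def q_def I_def J_def simp del: of_nat_Suc dest!: S(1) dest: inj)
  have pe: "p ` I \<inter> e ` E = {}"
    by (auto simp: p_def e_def I_def E_def simp del: of_nat_Suc split: if_splits dest!: S(1) simsun_signed dest: inj)
  have qe: "q ` J \<inter> e ` E = {}"
    by (auto simp: q_def e_def J_def E_def simp del: of_nat_Suc split: if_splits dest!: S(1) simsun_signed dest: inj)
  have "{w \<in> simsun_words (Suc n). Q (word_gae (Suc n) w)} = p ` I \<union> q ` J \<union> e ` E"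
  proof (intro equalityI subsetI)
    fix w assume "w \<in> {w \<in> simsun_words (Suc n). Q (word_gae (Suc n) w)}"
    then have w: "w \<in> simsun_words (Suc n)" "Q (word_gae (Suc n) w)" by auto
    obtain u i m where u: "u \<in> signed_words n" "i \<le> n" "\<bar>m\<bar> = ?M" "w = ins i m u"
      using simsun_signed[OF w(1)] by (rule signed_words_SucE)
    have u': "u \<in> simsun_words n" using w(1) simsun_words_ins_iff[OF u(1,3)] u(4) by blast
    have g: "word_gae (Suc n) w = (if i = n \<and> m = ?M then Suc n else word_gae n u)"
      using word_gae_ins[OF u(1-3)] u(4) by simp
    consider "m = ?M" "i = n" | "m = ?M" "i < n" | "m = - ?M" "i = 0" | j where "m = - ?M" "i = Suc j" "j < n"
    proof -
      have "m = ?M \<or> m = - ?M" using u(3) by linarith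
      moreover have "i = n \<or> i < n" using u(2) by linarith
      moreover have "i = 0 \<or> (\<exists>j. i = Suc j \<and> j < n)" using u(2) by (cases i) auto
      ultimately show ?thesis using that by blast
    qed
    then show "w \<in> p ` I \<union> q ` J \<union> e ` E"
    proof cases
      case 1
      then have "w = e u" "u \<in> E" using u' g w(2) u(4) by (simp_all add: e_def E_def)
      then show ?thesis by blast
    next
      case 2
      then have "i \<notin> tops u" using simsun_words_ins_pos[OF u' u(2)] w(1) u(4) by blast
      then have "(u, i) \<in> I" "w = p (u, i)" using u' g w(2) u(4) 2 by (simp_all add: I_def S_def p_def)
      then show ?thesis by blast
    next
      case 3
      then show ?thesis using w(1) u(4) not_simsun_words_ins_0_neg by blast
    next
      case 4
      then have "j \<notin> Suc ` tops u" using simsun_words_ins_neg[OF u' 4(3)] w(1) u(4) by blast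
      then have "(u, j) \<in> J" "w = q (u, j)" using u' g w(2) u(4) 4 by (simp_all add: J_def S_def q_def)
      then show ?thesis by blast
    qed
  next
    fix w assume "w \<in> p ` I \<union> q ` J \<union> e ` E"
    then consider u i where "u \<in> S" "i < n" "i \<notin> tops u" "w = ins i ?M u"
      | u j where "u \<in> S" "j < n" "j \<notin> Suc ` tops u" "w = ins (Suc j) (- ?M) u"
      | u where "Q (Suc n)" "u \<in> simsun_words n" "w = ins n ?M u"
      by (auto simp: p_def q_def e_def I_def J_def E_def split: if_splits)
    then show "w \<in> {w \<in> simsun_words (Suc n). Q (word_gae (Suc n) w)}"
    proof cases
      case 1
      then show ?thesis using simsun_words_ins_pos[OF S(2)[OF 1(1)], of i]
          word_gae_ins[OF S(1)[OF 1(1)], of i ?M] by (simp add: S_def)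
    next
      case 2
      then show ?thesis using simsun_words_ins_neg[OF S(2)[OF 2(1)], of j]
          word_gae_ins[OF S(1)[OF 2(1)], of "Suc j" "- ?M"] by (simp add: S_def)
    next
      case 3
      moreover have "n \<notin> tops u"
        using tops_less(1)[of u] length_signed_words[OF simsun_signed[OF 3(2)]] by blast
      ultimately show ?thesis using simsun_words_ins_pos[OF 3(2), of n]
          word_gae_ins[OF simsun_signed[OF 3(2)], of n ?M] by simp
    qed
  qed
  then have "simsun_sum (Suc n) Q \<phi> = sum (weight \<phi>) (p ` I) + sum (weight \<phi>) (q ` J) + sum (weight \<phi>) (e ` E)"
    unfolding simsun_sum_def using fin pq pe qe
    by (simp add: sum.union_disjoint Int_Un_distrib2)
  also have "sum (weight \<phi>) (p ` I) = (\<Sum>u\<in>S. \<Sum>i\<in>{..<n} - tops u. weight \<phi> (ins i ?M u))"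
    using fin inj_p unfolding I_def p_def by (simp add: sum.reindex sum.Sigma split_def)
  also have "sum (weight \<phi>) (q ` J) = (\<Sum>u\<in>S. \<Sum>j\<in>{..<n} - Suc ` tops u. weight \<phi> (ins (Suc j) (- ?M) u))"
    using fin inj_q unfolding J_def q_def by (simp add: sum.reindex sum.Sigma split_def)
  also have "sum (weight \<phi>) (e ` E) = (\<Sum>u\<in>E. weight \<phi> (ins n ?M u))"
    using inj_e unfolding e_def by (simp add: sum.reindex)
  also have "\<dots> = (\<Sum>u\<in>E. weight (append_op \<phi>) u)"
  proof (rule sum.cong[OF refl])
    fix u assume "u \<in> E"
    then have u: "u \<in> simsun_words n" by (auto simp: E_def split: if_splits)
    have "\<forall>a\<in>set u. \<bar>a\<bar> < ?M" using abs_in_signed_words[OF simsun_signed[OF u]] by fastforce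
    then show "weight \<phi> (ins n ?M u) = weight (append_op \<phi>) u"
      using weight_ins_end[of u ?M \<phi>] admissible_simsun[OF u] length_signed_words[OF simsun_signed[OF u]]
      by (simp add: admissible_def)
  qed
  also have "\<dots> = (if Q (Suc n) then simsun_sum n (\<lambda>_. True) (append_op \<phi>) else 0)"
    by (simp add: E_def simsun_sum_def)
  also have "(\<Sum>u\<in>S. \<Sum>i\<in>{..<n} - tops u. weight \<phi> (ins i ?M u)) +
      (\<Sum>u\<in>S. \<Sum>j\<in>{..<n} - Suc ` tops u. weight \<phi> (ins (Suc j) (- ?M) u)) = simsun_sum n Q (insert_op \<phi>)"
    unfolding sum.distrib[symmetric] simsun_sum_def S_def[symmetric]
  proof (rule sum.cong[OF refl])
    fix u assume u: "u \<in> S"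
    have "\<forall>a\<in>set u. \<bar>a\<bar> < ?M" using abs_in_signed_words[OF S(1)[OF u]] by fastforce
    then show "(\<Sum>i\<in>{..<n} - tops u. weight \<phi> (ins i ?M u)) +
      (\<Sum>j\<in>{..<n} - Suc ` tops u. weight \<phi> (ins (Suc j) (- ?M) u)) = weight (insert_op \<phi>) u"
      using sum_weight_ins[of u ?M \<phi>] admissible_simsun[OF S(2)[OF u]] S(3)[OF u]
      by (simp add: admissible_def)
  qed
  finally show ?thesis .
qed

lemma simsun_sum_cong: "(\<And>w. w \<in> simsun_words n \<Longrightarrow> Q (word_gae n w) = R (word_gae n w)) \<Longrightarrow> simsun_sum n Q \<phi> = simsun_sum n R \<phi>"
  unfolding simsun_sum_def by (rule sum.cong) auto

text \<open>
  If no value in \<open>{j<..n}\<close> satisfies \<open>Q\<close>, then the letters \<open>j + 1, \<dots>, n\<close> are never inserted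
  as positive last letters, and only the derivation acts.
\<close>

lemma simsun_sum_stable:
  assumes "j \<le> n" "\<And>k. j < k \<Longrightarrow> k \<le> n \<Longrightarrow> \<not> Q k"
  shows "simsun_sum n Q \<phi> = simsun_sum j Q ((insert_op ^^ (n - j)) \<phi>)"
  using assms
proof (induction n arbitrary: \<phi>)
  case (Suc n)
  show ?case
  proof (cases "j = Suc n")
    case False
    then have j: "j \<le> n" "\<not> Q (Suc n)" using Suc.prems by auto
    have "simsun_sum (Suc n) Q \<phi> = simsun_sum j Q ((insert_op ^^ (n - j)) (insert_op \<phi>))"
      using Suc.IH[OF j(1)] Suc.prems(2) j(2) by (simp add: simsun_sum_Suc)
    then show ?thesis using j(1) by (simp add: Suc_diff_le funpow_swap1)
  qed simp
qed simp

lemma simsun_sum_le: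
  assumes "j \<le> n"
  shows "simsun_sum n (\<lambda>g. g \<le> j) \<phi> = simsun_sum j (\<lambda>_. True) ((insert_op ^^ (n - j)) \<phi>)"
  using simsun_sum_stable[of j n "\<lambda>g. g \<le> j" \<phi>] assms word_gae_le
  by (auto intro: simsun_sum_cong)

lemma simsun_sum_eq:
  assumes "g < n"
  shows "simsun_sum n (\<lambda>h. h = Suc g) \<phi> = simsun_sum g (\<lambda>_. True) (append_op ((insert_op ^^ (n - Suc g)) \<phi>))"
proof -
  have "simsun_sum n (\<lambda>h. h = Suc g) \<phi> = simsun_sum (Suc g) (\<lambda>h. h = Suc g) ((insert_op ^^ (n - Suc g)) \<phi>)"
    using assms by (intro simsun_sum_stable) auto
  moreover have "simsun_sum g (\<lambda>h. h = Suc g) \<psi> = 0" for \<psi> :: "'a weighting"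
  proof -
    have "{w \<in> simsun_words g. word_gae g w = Suc g} = {}"
      using word_gae_le by (metis (mono_tags, lifting) Collect_empty_eq not_less_eq_eq order_refl)
    then show ?thesis by (simp only: simsun_sum_def sum.empty)
  qed
  ultimately show ?thesis by (simp add: simsun_sum_Suc)
qed

text \<open>
  The functional \<open>\<phi>\<close> sends \<open>(u + v - w\<^sup>2 - x) M\<close> to \<open>0\<close> for every monomial \<open>M\<close>, so it
  treats \<open>u + v - w\<^sup>2\<close> as the scalar \<open>x\<close>.
\<close>

definition conserves :: "'a::comm_ring_1 \<Rightarrow> 'a weighting \<Rightarrow> bool" where
  "conserves x \<phi> \<longleftrightarrow> (\<forall>a b c. \<phi> (a + 1) b c + \<phi> a (b + 1) c - \<phi> a b (c + 2) = x * \<phi> a b c)"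

text \<open>
  This is where the derivation kills \<open>u + v - w\<^sup>2\<close>: by the product rule, the derivative of
  \<open>(u + v - w\<^sup>2 - x) M\<close> is \<open>(u + v - w\<^sup>2 - x) \<partial>M\<close>, which \<open>\<phi>\<close> sends to \<open>0\<close>.
\<close>

lemma conserves_insert_op:
  assumes "conserves x \<phi>"
  shows "conserves x (insert_op \<phi>)"
  unfolding conserves_def
proof (intro allI)
  fix a b c
  have C: "\<phi> a b (Suc (Suc c)) = \<phi> (Suc a) b c + \<phi> a (Suc b) c - x * \<phi> a b c" for a b c
    using assms by (simp add: conserves_def diff_eq_eq eq_diff_eq add.commute)
  show "insert_op \<phi> (a + 1) b c + insert_op \<phi> a (b + 1) c - insert_op \<phi> a b (c + 2) = x * insert_op \<phi> a b c"
    by (cases a; cases b; cases c) (simp_all add: insert_op_def C algebra_simps)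
qed

lemma conserves_funpow: "conserves x \<phi> \<Longrightarrow> conserves x ((insert_op ^^ m) \<phi>)"
  by (induction m) (auto intro: conserves_insert_op)

text \<open>
  The product rule \<open>\<partial>(w M) = w \<partial>M + (u + v) M\<close>; the term \<open>w \<partial>M\<close> is written with the
  two operators in the opposite order because they act on functionals.
\<close>

lemma append_insert_op:
  "append_op (insert_op \<phi>) a b c = insert_op (append_op \<phi>) a b c + \<phi> (a + 1) b c + \<phi> a (b + 1) c"
  by (cases c) (simp_all add: append_op_def insert_op_def algebra_simps)

text \<open>
  With \<open>f = g - 1\<close>, all three sums are sums over the words of size \<open>f\<close>. There the difference of
  the first two is \<open>\<psi>\<close> applied to \<open>\<partial>(w M) - w (\<partial>M + w M) = (u + v - w\<^sup>2) M\<close>, summed over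
  the monomials \<open>M\<close> of these words, where \<open>\<psi>\<close> is \<open>\<phi>\<close> after \<open>n - g - 1\<close> derivations.
\<close>

lemma simsun_sum_recurrence:
  assumes "conserves x \<phi>" "1 \<le> g" "g < n"
  shows "simsun_sum n (\<lambda>h. h = g) \<phi> =
    simsun_sum n (\<lambda>h. h = Suc g) \<phi> + x * simsun_sum (n - 2) (\<lambda>h. h \<le> g - 1) \<phi>"
proof -
  define \<psi> where "\<psi> = (insert_op ^^ (n - Suc g)) \<phi>"
  obtain f where g: "g = Suc f" using assms(2) by (cases g) auto
  have c: "conserves x \<psi>" unfolding \<psi>_def using assms(1) by (rule conserves_funpow)
  have "n - g = Suc (n - Suc g)" using assms(3) by simp
  then have "simsun_sum n (\<lambda>h. h = g) \<phi> = simsun_sum f (\<lambda>_. True) (append_op (insert_op \<psi>))"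
    using simsun_sum_eq[of f n \<phi>] assms(3) by (simp add: g \<psi>_def)
  moreover have "simsun_sum n (\<lambda>h. h = Suc g) \<phi> =
      simsun_sum f (\<lambda>_. True) (insert_op (append_op \<psi>)) + simsun_sum f (\<lambda>_. True) (append_op (append_op \<psi>))"
    using simsun_sum_eq[of g n \<phi>] assms(3) by (simp add: \<psi>_def g simsun_sum_Suc)
  moreover have "simsun_sum (n - 2) (\<lambda>h. h \<le> g - 1) \<phi> = simsun_sum f (\<lambda>_. True) \<psi>"
  proof -
    have "n - 2 - f = n - Suc g" using g by simp
    then show ?thesis using simsun_sum_le[of f "n - 2" \<phi>] assms(3) by (simp add: g \<psi>_def)
  qed
  moreover have "weight (append_op (insert_op \<psi>)) w =
      weight (insert_op (append_op \<psi>)) w + weight (append_op (append_op \<psi>)) w + x * weight \<psi> w" for w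
  proof -
    have "append_op (insert_op \<psi>) a b c =
        insert_op (append_op \<psi>) a b c + append_op (append_op \<psi>) a b c + x * \<psi> a b c" for a b c
    proof -
      have "\<psi> (a + 1) b c + \<psi> a (b + 1) c = \<psi> a b (c + 2) + x * \<psi> a b c"
        using c unfolding conserves_def by (simp add: diff_eq_eq add.commute)
      then show ?thesis unfolding append_insert_op by (simp add: append_op_def add.assoc)
    qed
    then show ?thesis by (simp add: weight_def Let_def)
  qed
  ultimately show ?thesis
    by (simp add: simsun_sum_def sum.distrib sum_distrib_left)
qed

section \<open>From signed permutations to words\<close>

lemma length_word [simp]: "length (word n \<sigma>) = n"
  by (simp add: word_def)

lemma nth_word: "i < n \<Longrightarrow> word n \<sigma> ! i = \<sigma> (int i + 1)"
  by (simp add: word_def add.commute)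

lemma signed_perms_abs:
  assumes "\<sigma> \<in> signed_perms n"
  shows "inj_on (\<lambda>i. \<bar>\<sigma> i\<bar>) {1..int n}" "(\<lambda>i. \<bar>\<sigma> i\<bar>) ` {1..int n} = {1..int n}"
proof -
  have perm: "\<sigma> permutes ({- int n..int n} - {0})" and odd: "\<And>i. \<sigma> (- i) = - \<sigma> i"
    using assms by (auto simp: signed_perms_def)
  show inj: "inj_on (\<lambda>i. \<bar>\<sigma> i\<bar>) {1..int n}"
  proof (rule inj_onI)
    fix i j assume ij: "i \<in> {1..int n}" "j \<in> {1..int n}" "\<bar>\<sigma> i\<bar> = \<bar>\<sigma> j\<bar>"
    then have "\<sigma> i = \<sigma> j \<or> \<sigma> i = \<sigma> (- j)" unfolding odd by linarith
    then have "i = j \<or> i = - j" using permutes_inj[OF perm] by (auto dest: injD)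
    then show "i = j" using ij by auto
  qed
  have "(\<lambda>i. \<bar>\<sigma> i\<bar>) ` {1..int n} \<subseteq> {1..int n}"
  proof
    fix x assume "x \<in> (\<lambda>i. \<bar>\<sigma> i\<bar>) ` {1..int n}"
    then obtain i where i: "i \<in> {1..int n}" "x = \<bar>\<sigma> i\<bar>" by auto
    then have "\<sigma> i \<in> {- int n..int n} - {0}" using permutes_in_image[OF perm] by auto
    then show "x \<in> {1..int n}" using i by auto
  qed
  then show "(\<lambda>i. \<bar>\<sigma> i\<bar>) ` {1..int n} = {1..int n}"
    using inj by (intro endo_inj_surj) auto
qed

text \<open>
  A signed permutation is determined by its word because it is odd and fixes everything outside
  \<open>{\<plusminus>1, \<dots>, \<plusminus>n}\<close>; conversely the odd extension of a word is injective on this finite set and maps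
  it to itself.
\<close>

lemma bij_betw_word: "bij_betw (word n) (signed_perms n) (signed_words n)"
proof (rule bij_betw_imageI)
  show "inj_on (word n) (signed_perms n)"
  proof (rule inj_onI)
    fix \<sigma> \<tau> assume s: "\<sigma> \<in> signed_perms n" and t: "\<tau> \<in> signed_perms n" and eq: "word n \<sigma> = word n \<tau>"
    have pos: "\<sigma> i = \<tau> i" if "1 \<le> i" "i \<le> int n" for i
      using eq that by (auto simp: word_def)
    show "\<sigma> = \<tau>"
    proof
      fix i
      consider "1 \<le> i" "i \<le> int n" | "1 \<le> - i" "- i \<le> int n" | "i \<notin> {- int n..int n} - {0}"
        by force
      then show "\<sigma> i = \<tau> i"
      proof cases
        case 2
        then have "\<sigma> (- (- i)) = \<tau> (- (- i))"
          using pos[of "- i"] s t unfolding signed_perms_def by (metis (mono_tags, lifting) mem_Collect_eq)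
        then show ?thesis by simp
      next
        case 3
        then show ?thesis using s t unfolding signed_perms_def by (metis (mono_tags, lifting) mem_Collect_eq permutes_not_in)
      qed (rule pos)
    qed
  qed
  show "word n ` signed_perms n = signed_words n"
  proof (intro equalityI subsetI)
    fix w assume "w \<in> word n ` signed_perms n"
    then obtain \<sigma> where "\<sigma> \<in> signed_perms n" "w = word n \<sigma>" by auto
    moreover from this have "distinct (map (\<lambda>i. \<bar>\<sigma> i\<bar>) [1..int n])"
      using signed_perms_abs(1)[of \<sigma> n] by (simp add: distinct_map)
    ultimately show "w \<in> signed_words n"
      using signed_perms_abs(2)[of \<sigma> n]
      by (simp add: signed_words_def word_def image_image o_def)
  next
    fix w assume w: "w \<in> signed_words n"
    then have len: "length w = n" by (rule length_signed_words)
    define f where "f i = w ! nat (i - 1)" for i :: int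
    define \<sigma> where "\<sigma> i = (if 1 \<le> i \<and> i \<le> int n then f i
      else if 1 \<le> - i \<and> - i \<le> int n then - f (- i) else i)" for i
    have f: "1 \<le> \<bar>f i\<bar>" "\<bar>f i\<bar> \<le> int n" if "1 \<le> i" "i \<le> int n" for i
      using abs_in_signed_words[OF w, of "f i"] that len by (auto simp: f_def)
    have f_inj: "i = j" if "1 \<le> i" "i \<le> int n" "1 \<le> j" "j \<le> int n" "\<bar>f i\<bar> = \<bar>f j\<bar>" for i j
    proof -
      have "map abs w ! nat (i - 1) = map abs w ! nat (j - 1)" using that len by (simp add: f_def)
      moreover have "distinct (map abs w)" using w by (simp add: signed_words_def)
      ultimately have "nat (i - 1) = nat (j - 1)" using that len by (subst (asm) nth_eq_iff_index_eq) auto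
      then show ?thesis using that by simp
    qed
    let ?S = "{- int n..int n} - {0}"
    have odd: "\<sigma> (- i) = - \<sigma> i" for i by (auto simp: \<sigma>_def)
    have abs_\<sigma>: "\<bar>\<sigma> i\<bar> = \<bar>f \<bar>i\<bar>\<bar>" if "i \<in> ?S" for i
      using that by (auto simp: \<sigma>_def)
    have "inj_on \<sigma> ?S"
    proof (rule inj_onI)
      fix i j assume ij: "i \<in> ?S" "j \<in> ?S" "\<sigma> i = \<sigma> j"
      have range: "1 \<le> \<bar>i\<bar>" "\<bar>i\<bar> \<le> int n" "1 \<le> \<bar>j\<bar>" "\<bar>j\<bar> \<le> int n" using ij(1,2) by auto
      have "\<bar>f \<bar>i\<bar>\<bar> = \<bar>f \<bar>j\<bar>\<bar>" using ij abs_\<sigma> by metis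
      with range have "\<bar>i\<bar> = \<bar>j\<bar>" by (rule f_inj)
      then consider "i = j" | "j = - i" by linarith
      then show "i = j"
      proof cases
        case 2
        then have "\<sigma> i = 0" using ij(3) odd[of i] by simp
        then show ?thesis using abs_\<sigma>[OF ij(1)] f(1)[OF range(1,2)] by simp
      qed
    qed
    moreover have "\<sigma> ` ?S \<subseteq> ?S"
    proof
      fix x assume "x \<in> \<sigma> ` ?S"
      then obtain i where i: "i \<in> ?S" "x = \<sigma> i" by blast
      show "x \<in> ?S"
        using i f[of i] f[of "- i"] by (auto simp: \<sigma>_def split: if_splits)
    qed
    ultimately have "bij_betw \<sigma> ?S ?S"
      by (simp add: bij_betw_def endo_inj_surj)
    then have "\<sigma> permutes ?S" by (rule bij_imp_permutes) (auto simp: \<sigma>_def)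
    moreover have "word n \<sigma> = w" by (rule nth_equalityI) (auto simp: len nth_word \<sigma>_def f_def)
    ultimately show "w \<in> word n ` signed_perms n"
      unfolding signed_perms_def using odd by blast
  qed
qed

text \<open>
  The first letter of \<open>restr k w\<close> is the first letter of absolute value at most \<open>k\<close>, so it is a
  left-to-right minimum of the absolute values; every such minimum \<open>a\<close> arises in this way with
  \<open>k = \<bar>a\<bar>\<close>, as the absolute values are distinct. The interval starts at \<open>s = 1\<close> for
  \<open>RSII_B\<close> and at \<open>s = 2\<close> for \<open>RSII_D\<close>.
\<close>

lemma left_right_minima_positive_iff:
  fixes f :: "int \<Rightarrow> int"
  assumes inj: "inj_on (\<lambda>i. \<bar>f i\<bar>) {s..e}"
  shows "(\<forall>i\<in>{s..e}. \<bar>f i\<bar> = Min ((\<lambda>j. \<bar>f j\<bar>) ` {s..i}) \<longrightarrow> f i > 0) \<longleftrightarrow>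
    (\<forall>k. restr k (map f [s..e]) \<noteq> [] \<longrightarrow> 0 < hd (restr k (map f [s..e])))" (is "?L \<longleftrightarrow> ?R")
proof -
  have hd: "hd (restr k (map f [s..e])) = f i"
    if "i \<in> {s..e}" "\<bar>f i\<bar> \<le> int k" "\<And>j. j \<in> {s..<i} \<Longrightarrow> int k < \<bar>f j\<bar>" for i k
  proof -
    have "[s..e] = [s..i - 1] @ i # [i + 1..e]" using that(1) by (intro upto_split3) auto
    moreover have "restr k (map f [s..i - 1]) = []"
      using that(3) by (fastforce simp: restr_def filter_empty_conv)
    ultimately show ?thesis using that(2) by (simp add: restr_def)
  qed
  show ?thesis
  proof
    assume L: ?L
    show ?R
    proof (intro allI impI)
      fix k assume "restr k (map f [s..e]) \<noteq> []"
      then have ne: "{j \<in> {s..e}. \<bar>f j\<bar> \<le> int k} \<noteq> {}" by (auto simp: restr_def filter_empty_conv)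
      have fin: "finite {j \<in> {s..e}. \<bar>f j\<bar> \<le> int k}"
        by (rule finite_subset[of _ "{s..e}"]) auto
      define i where "i = Min {j \<in> {s..e}. \<bar>f j\<bar> \<le> int k}"
      have i: "i \<in> {s..e}" "\<bar>f i\<bar> \<le> int k"
        using Min_in[OF fin ne] unfolding i_def by simp_all
      have before: "int k < \<bar>f j\<bar>" if "j \<in> {s..<i}" for j
      proof (rule ccontr)
        assume "\<not> int k < \<bar>f j\<bar>"
        then have "i \<le> j" unfolding i_def using that i by (intro Min_le[OF fin]) auto
        then show False using that by simp
      qed
      have "Min ((\<lambda>j. \<bar>f j\<bar>) ` {s..i}) = \<bar>f i\<bar>"
      proof (rule Min_eqI)
        fix y assume "y \<in> (\<lambda>j. \<bar>f j\<bar>) ` {s..i}"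
        then obtain j where "y = \<bar>f j\<bar>" "j \<in> {s..<i} \<or> j = i" by force
        then show "\<bar>f i\<bar> \<le> y" using before[of j] i by auto
      qed (use i in auto)
      then have "f i > 0" using L i by auto
      then show "0 < hd (restr k (map f [s..e]))" using hd[OF i before] by simp
    qed
  next
    assume R: ?R
    show ?L
    proof (intro ballI impI)
      fix i assume i: "i \<in> {s..e}" "\<bar>f i\<bar> = Min ((\<lambda>j. \<bar>f j\<bar>) ` {s..i})"
      let ?k = "nat \<bar>f i\<bar>"
      have before: "int ?k < \<bar>f j\<bar>" if "j \<in> {s..<i}" for j
      proof -
        have "\<bar>f i\<bar> \<le> \<bar>f j\<bar>" unfolding i(2) using that by (intro Min_le) auto
        moreover have "\<bar>f i\<bar> \<noteq> \<bar>f j\<bar>" using inj_onD[OF inj, of i j] i(1) that by auto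
        ultimately show ?thesis by simp
      qed
      have "f i \<in> set (restr ?k (map f [s..e]))" using i(1) by (simp add: restr_def)
      then have "restr ?k (map f [s..e]) \<noteq> []" by auto
      then show "f i > 0" using R hd[OF i(1) _ before] by fastforce
    qed
  qed
qed

lemma restricted_word_eq: "restricted_word n \<sigma> k = restr k (word n \<sigma>)"
  by (simp add: restricted_word_def restr_def)

lemma gae_eq: "gae n \<sigma> = word_gae n (word n \<sigma>)"
  by (simp add: gae_def word_gae_def augmenting_def restricted_word_eq)

lemma nva_eq: "nva n \<sigma> = card (adj outward (word n \<sigma>))"
proof -
  have "{i \<in> {2..int n}. \<sigma> i < 0 \<and> \<sigma> (i - 1) > \<sigma> i \<and> \<bar>\<sigma> (i - 1)\<bar> < \<bar>\<sigma> i\<bar>} =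
      (\<lambda>j. int j + 2) ` adj outward (word n \<sigma>)" (is "?A = ?B")
  proof (intro equalityI subsetI)
    fix i assume i: "i \<in> ?A"
    then have "nat (i - 2) \<in> adj outward (word n \<sigma>)"
      by (auto simp: adj_def nth_word outward_def nat_diff_distrib)
    moreover have "i = int (nat (i - 2)) + 2" using i by auto
    ultimately show "i \<in> ?B" by blast
  next
    fix i assume "i \<in> ?B"
    then obtain j where "i = int j + 2" "j \<in> adj outward (word n \<sigma>)" by auto
    then show "i \<in> ?A" by (auto simp: adj_def nth_word outward_def add.commute)
  qed
  moreover have "inj (\<lambda>j. int j + 2)" by (rule injI) simp
  ultimately show ?thesis unfolding nva_def by (simp add: card_image inj_on_subset)
qed

lemma RSII_iff:
  "\<sigma> \<in> RSII n \<longleftrightarrow> \<sigma> \<in> signed_perms n \<and> (\<forall>k. \<not> has_double_descent (restr k (word n \<sigma>)))"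
proof -
  have "(\<forall>k\<in>{1..n}. \<not> has_double_descent (restr k w)) \<longleftrightarrow> (\<forall>k. \<not> has_double_descent (restr k w))"
    if w: "w \<in> signed_words n" for w
  proof
    assume A: "\<forall>k\<in>{1..n}. \<not> has_double_descent (restr k w)"
    have nil: "restr 0 w = []"
      using abs_in_signed_words[OF w] by (fastforce simp: restr_def filter_empty_conv)
    show "\<forall>k. \<not> has_double_descent (restr k w)"
    proof
      fix k
      have "restr k w = restr (min k n) w" using w by (simp add: min_def restr_all)
      moreover have "min k n \<in> {1..n} \<or> min k n = 0" by auto
      ultimately show "\<not> has_double_descent (restr k w)"
        using A nil by (auto simp: has_double_descent_def)
    qed
  qed simp
  then show ?thesis
    using bij_betw_apply[OF bij_betw_word[of n]] by (auto simp: RSII_def restricted_word_eq)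
qed

lemma RSII_B_iff: "\<sigma> \<in> RSII_B n \<longleftrightarrow> \<sigma> \<in> signed_perms n \<and> word n \<sigma> \<in> simsun_words n"
proof (cases "\<sigma> \<in> signed_perms n")
  case True
  then have "word n \<sigma> \<in> signed_words n" by (rule bij_betw_apply[OF bij_betw_word])
  then show ?thesis
    using True left_right_minima_positive_iff[OF signed_perms_abs(1)[OF True]]
    by (auto simp: RSII_B_def RSII_iff simsun_words_def admissible_def word_def[symmetric])
qed (simp add: RSII_B_def RSII_iff)

lemma bij_betw_filter:
  assumes "bij_betw f A B"
  shows "bij_betw f {x \<in> A. P (f x)} {y \<in> B. P y}"
  using assms unfolding bij_betw_def by (auto intro: inj_on_subset)

lemma RSII_B_gae_sum:
  "(\<Sum>\<sigma>\<in>RSII_B_gae n g. F (nva n \<sigma>)) = simsun_sum n (\<lambda>h. h = g) (\<lambda>a b c. F a)"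
proof -
  have "RSII_B_gae n g = {\<sigma> \<in> signed_perms n. word n \<sigma> \<in> simsun_words n \<and> word_gae n (word n \<sigma>) = g}"
    by (auto simp: RSII_B_gae_def RSII_B_iff gae_eq)
  moreover have "{w \<in> signed_words n. w \<in> simsun_words n \<and> word_gae n w = g} =
      {w \<in> simsun_words n. word_gae n w = g}"
    using simsun_signed by blast
  ultimately have "bij_betw (word n) (RSII_B_gae n g) {w \<in> simsun_words n. word_gae n w = g}"
    using bij_betw_filter[OF bij_betw_word[of n], of "\<lambda>w. w \<in> simsun_words n \<and> word_gae n w = g"]
    by simp
  then show ?thesis
    unfolding simsun_sum_def weight_def Let_def nva_eq by (rule sum.reindex_bij_betw)
qed

section \<open>Prefixing a negative letter\<close>

lemma restr_nonempty:
  assumes "w \<in> signed_words n" "k \<in> {1..n}"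
  shows "restr k w \<noteq> []"
proof -
  have "1 \<in> abs ` set w" using assms by (simp add: signed_words_def)
  then obtain a where "a \<in> set w" "\<bar>a\<bar> = 1" by auto
  then have "a \<in> set (restr k w)" using assms(2) by (simp add: restr_def)
  then show ?thesis by auto
qed

lemma has_double_descent_Cons:
  assumes "w \<noteq> [] \<longrightarrow> a < hd w"
  shows "has_double_descent (a # w) \<longleftrightarrow> has_double_descent w"
proof -
  have "adj P (a # w) = Suc ` adj P w" if "P \<in> {outward, inward}" for P
    using assms that by (auto simp: adj_Cons outward_def inward_def)
  then have "tops (a # w) = Suc ` tops w" by (simp add: image_Un)
  then show ?thesis
    unfolding has_double_descent_iff by (auto simp: inj_image_mem_iff)
qed

text \<open>
  The inverse of standardization: it shifts the letters so that the absolute value \<open>m\<close> becomes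
  free, keeping signs, the order of the letters and the order of their absolute values.
\<close>

definition gap_at :: "nat \<Rightarrow> int \<Rightarrow> int" where
  "gap_at m a = (if int m \<le> \<bar>a\<bar> then a + sgn a else a)"

context
  fixes m :: nat
  assumes m: "1 \<le> m"
begin

lemma abs_gap_at: "\<bar>gap_at m a\<bar> = (if int m \<le> \<bar>a\<bar> then \<bar>a\<bar> + 1 else \<bar>a\<bar>)"
  using m by (auto simp: gap_at_def sgn_if)

lemma gap_at_less_iff: "gap_at m a < gap_at m b \<longleftrightarrow> a < b"
  using m by (auto simp: gap_at_def sgn_if)

lemma gap_at_pos_iff: "0 < gap_at m a \<longleftrightarrow> 0 < a"
  using m by (auto simp: gap_at_def sgn_if)

lemma abs_gap_at_less_iff: "\<bar>gap_at m a\<bar> < \<bar>gap_at m b\<bar> \<longleftrightarrow> \<bar>a\<bar> < \<bar>b\<bar>"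
  by (auto simp: abs_gap_at)

lemma abs_gap_at_neq: "\<bar>gap_at m a\<bar> \<noteq> int m"
  by (auto simp: abs_gap_at)

lemma gap_at_surj:
  assumes "\<bar>b\<bar> \<noteq> int m"
  shows "\<exists>a. b = gap_at m a"
  using assms m
  by (intro exI[of _ "if int m < \<bar>b\<bar> then b - sgn b else b"]) (auto simp: gap_at_def sgn_if)

lemma inj_gap_at: "inj (gap_at m)"
  by (rule injI) (metis gap_at_less_iff not_less_iff_gr_or_eq)

lemma restr_map_gap_at:
  "restr k (map (gap_at m) w) = map (gap_at m) (restr (if m \<le> k then k - 1 else k) w)"
proof -
  have "\<bar>gap_at m a\<bar> \<le> int k \<longleftrightarrow> \<bar>a\<bar> \<le> int (if m \<le> k then k - 1 else k)" for a
    using m by (auto simp: abs_gap_at of_nat_diff)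
  then show ?thesis unfolding restr_def filter_map o_def by simp
qed

text \<open>
  The thresholds \<open>m - 1\<close> and \<open>m\<close> give the same restriction of the shifted word, but every
  restriction of \<open>w\<close> is reached.
\<close>

lemma all_restr_gap_at_iff:
  "(\<forall>k. P (restr k (map (gap_at m) w))) \<longleftrightarrow> (\<forall>k. P (map (gap_at m) (restr k w)))"
proof
  assume L: "\<forall>k. P (restr k (map (gap_at m) w))"
  show "\<forall>k. P (map (gap_at m) (restr k w))"
  proof
    fix k show "P (map (gap_at m) (restr k w))"
      using L[rule_format, of "if m \<le> k then Suc k else k"]
      by (auto simp: restr_map_gap_at split: if_splits)
  qed
qed (simp add: restr_map_gap_at)

lemma has_double_descent_map_gap_at:
  "has_double_descent (map (gap_at m) w) \<longleftrightarrow> has_double_descent w"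
  unfolding has_double_descent_def by (auto simp: gap_at_less_iff)

definition prefix_neg :: "int list \<Rightarrow> int list" where
  "prefix_neg w = - int m # map (gap_at m) w"

lemma signed_words_prefix_neg_iff:
  assumes "m \<le> Suc n"
  shows "prefix_neg w \<in> signed_words (Suc n) \<longleftrightarrow> w \<in> signed_words n"
proof -
  have S: "u \<in> signed_words l \<longleftrightarrow> distinct (map abs u) \<and> abs ` set u \<subseteq> {1..int l} \<and> length u = l" for u l
  proof
    assume u: "distinct (map abs u) \<and> abs ` set u \<subseteq> {1..int l} \<and> length u = l"
    then have "card (abs ` set u) = l" using distinct_card[of "map abs u"] by simp
    then have "abs ` set u = {1..int l}" using u by (intro card_subset_eq) auto
    then show "u \<in> signed_words l" using u by (simp add: signed_words_def)
  qed (auto simp: length_signed_words, auto simp: signed_words_def)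
  have "inj_on (\<lambda>a. \<bar>gap_at m a\<bar>) A \<longleftrightarrow> inj_on abs A" for A
    unfolding inj_on_def using abs_gap_at_less_iff by (metis (no_types, lifting) not_less_iff_gr_or_eq)
  moreover have "distinct w" if "distinct (map abs w) \<or> distinct (map (\<lambda>a. \<bar>gap_at m a\<bar>) w)"
    using that by (auto simp: distinct_map)
  ultimately have "distinct (map abs (prefix_neg w)) \<longleftrightarrow> distinct (map abs w)"
    using abs_gap_at_neq unfolding prefix_neg_def
    by (auto simp: o_def distinct_map image_iff) metis+
  moreover have "\<bar>gap_at m a\<bar> \<in> {1..int (Suc n)} \<longleftrightarrow> \<bar>a\<bar> \<in> {1..int n}" for a
    using assms m by (auto simp: abs_gap_at)
  then have "abs ` set (prefix_neg w) \<subseteq> {1..int (Suc n)} \<longleftrightarrow> abs ` set w \<subseteq> {1..int n}"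
    using assms m unfolding prefix_neg_def by (auto simp: image_subset_iff)
  ultimately show ?thesis unfolding S by (auto simp: prefix_neg_def)
qed

text \<open>
  When the remaining restrictions start with positive letters, a negative letter in front is
  followed by an ascent and cannot take part in a double descent.
\<close>

lemma simsun_words_prefix_neg_iff:
  assumes "m \<le> Suc n"
  shows "prefix_neg w \<in> signed_words (Suc n) \<and> (\<forall>k. \<not> has_double_descent (restr k (prefix_neg w)))
      \<and> (\<forall>k. restr k (tl (prefix_neg w)) \<noteq> [] \<longrightarrow> 0 < hd (restr k (tl (prefix_neg w)))) \<longleftrightarrow>
    w \<in> simsun_words n"
proof -
  have pos: "(\<forall>k. restr k (tl (prefix_neg w)) \<noteq> [] \<longrightarrow> 0 < hd (restr k (tl (prefix_neg w)))) \<longleftrightarrow>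
      (\<forall>k. restr k w \<noteq> [] \<longrightarrow> 0 < hd (restr k w))"
    unfolding prefix_neg_def list.sel
    using all_restr_gap_at_iff[of "\<lambda>u. u \<noteq> [] \<longrightarrow> 0 < hd u" w] by (auto simp: hd_map gap_at_pos_iff)
  moreover have "(\<forall>k. \<not> has_double_descent (restr k (prefix_neg w))) \<longleftrightarrow>
      (\<forall>k. \<not> has_double_descent (restr k w))"
    if P: "\<forall>k. restr k (tl (prefix_neg w)) \<noteq> [] \<longrightarrow> 0 < hd (restr k (tl (prefix_neg w)))"
  proof -
    have "has_double_descent (restr k (prefix_neg w)) \<longleftrightarrow> has_double_descent (restr k (tl (prefix_neg w)))" for k
    proof (cases "m \<le> k")
      case True
      then have "restr k (prefix_neg w) = - int m # restr k (tl (prefix_neg w))"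
        by (simp add: restr_def prefix_neg_def)
      moreover have "restr k (tl (prefix_neg w)) \<noteq> [] \<longrightarrow> - int m < hd (restr k (tl (prefix_neg w)))"
        using P by fastforce
      ultimately show ?thesis by (simp only: has_double_descent_Cons)
    qed (simp add: restr_def prefix_neg_def)
    then show ?thesis
      using all_restr_gap_at_iff[of "\<lambda>u. \<not> has_double_descent u" w]
      by (simp add: prefix_neg_def has_double_descent_map_gap_at)
  qed
  ultimately show ?thesis
    unfolding signed_words_prefix_neg_iff[OF assms] simsun_words_def admissible_def by blast
qed

text \<open>
  Above \<open>m\<close> the augmenting elements are shifted by one, and \<open>m\<close> itself cannot be augmenting, as
  only \<open>-m\<close> occurs.
\<close>

lemma word_gae_prefix_neg_less_iff:
  assumes "w \<in> signed_words n" "m \<le> Suc n"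
  shows "word_gae (Suc n) (prefix_neg w) < m \<longleftrightarrow> word_gae n w < m"
proof -
  have last: "last (restr k (prefix_neg w)) =
      (if restr (k - 1) w = [] then - int m else gap_at m (last (restr (k - 1) w)))" if "m \<le> k" for k
  proof -
    have "restr k (prefix_neg w) = - int m # map (gap_at m) (restr (k - 1) w)"
      using that restr_map_gap_at[of k w] by (simp add: prefix_neg_def restr_def)
    then show ?thesis by (simp add: last_map)
  qed
  have m_ok: "last (restr m (prefix_neg w)) \<noteq> int m"
    using last[of m] m abs_gap_at_neq[of "last (restr (m - 1) w)"] by auto
  have Suc_iff: "last (restr (Suc k) (prefix_neg w)) = int (Suc k) \<longleftrightarrow> last (restr k w) = int k"
    if "k \<in> {m..n}" for k
  proof -
    have "restr k w \<noteq> []" using restr_nonempty[OF assms(1)] that m by auto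
    moreover have "gap_at m a = int (Suc k) \<longleftrightarrow> a = int k" for a
      using that m by (auto simp: gap_at_def sgn_if)
    ultimately show ?thesis using last[of "Suc k"] that by simp
  qed
  have split: "{m..Suc n} = insert m (Suc ` {m..n})"
    using assms(2) by (auto simp: image_Suc_atLeastAtMost)
  have "(\<forall>k\<in>{m..Suc n}. last (restr k (prefix_neg w)) \<noteq> int k) \<longleftrightarrow>
      (\<forall>k\<in>{m..n}. last (restr k w) \<noteq> int k)"
    unfolding split using m_ok Suc_iff by blast
  then show ?thesis using m by (simp add: word_gae_less_iff)
qed

lemma card_outward_prefix_neg:
  assumes "w \<in> simsun_words n"
  shows "card (adj outward (prefix_neg w)) = card (adj outward w)"
proof -
  have "adj outward (map (gap_at m) w) = adj outward w"
    unfolding adj_map by (simp add: adj_def outward_def gap_at_less_iff abs_gap_at_less_iff)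
  moreover have "\<not> outward (- int m) (hd (map (gap_at m) w))" if "w \<noteq> []"
  proof -
    have "0 < hd w" using admissible_simsun[OF assms] that by (simp add: admissible_def)
    then have "0 < hd (map (gap_at m) w)" using that by (simp add: hd_map gap_at_pos_iff)
    then show ?thesis by (simp add: outward_def)
  qed
  ultimately show ?thesis unfolding prefix_neg_def by (auto simp: card_adj_Cons)
qed

text \<open>
  No letter behind the first one has absolute value \<open>m\<close>, so these letters are the image of a
  unique word under the shift. It satisfies the conditions for \<open>RSII_B n'\<close>, and
  \<open>\<bar>\<sigma> 1\<bar> > gae n \<sigma>\<close> turns into the bound on its greatest augmenting element.
\<close>

lemma RSII_D_first_iff:
  assumes n: "n = Suc n'"
  shows "\<sigma> \<in> RSII_D_first n (- int m) \<longleftrightarrow> \<sigma> \<in> signed_perms n \<and>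
    (\<exists>w. word n \<sigma> = prefix_neg w \<and> m \<le> n \<and> w \<in> simsun_words n' \<and> word_gae n' w < m)"
proof (cases "\<sigma> \<in> signed_perms n")
  case True
  let ?w = "word n \<sigma>"
  have w: "?w \<in> signed_words n" using True by (rule bij_betw_apply[OF bij_betw_word])
  have w_Cons: "?w = \<sigma> 1 # map \<sigma> [2..int n]"
    using n by (simp add: word_def upto_rec1)
  have inj: "inj_on (\<lambda>i. \<bar>\<sigma> i\<bar>) {2..int n}"
    using signed_perms_abs(1)[OF True] by (rule inj_on_subset) auto
  have "\<sigma> \<in> RSII_D_first n (- int m) \<longleftrightarrow> \<sigma> 1 = - int m \<and>
    (\<forall>k. \<not> has_double_descent (restr k ?w)) \<and> word_gae n ?w < m \<and>
    (\<forall>k. restr k (tl ?w) \<noteq> [] \<longrightarrow> 0 < hd (restr k (tl ?w)))"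
    using True m left_right_minima_positive_iff[OF inj]
    by (auto simp: RSII_D_first_def RSII_D_def RSII_iff gae_eq w_Cons)
  also have "\<dots> \<longleftrightarrow> (\<exists>w. ?w = prefix_neg w \<and> m \<le> n \<and> w \<in> simsun_words n' \<and> word_gae n' w < m)"
    (is "?L \<longleftrightarrow> ?R")
  proof
    assume L: ?L
    have "m \<le> n" using L abs_in_signed_words[OF w, of "\<sigma> 1"] by (simp add: w_Cons)
    have "distinct (map abs ?w)" using w by (simp add: signed_words_def)
    then have "\<bar>\<sigma> 1\<bar> \<notin> abs ` set (map \<sigma> [2..int n])" unfolding w_Cons by (simp add: image_image)
    then have "\<bar>b\<bar> \<noteq> int m" if "b \<in> set (map \<sigma> [2..int n])" for b
      using L that by (metis abs_minus_cancel abs_of_nat image_eqI)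
    then have "\<forall>b\<in>set (map \<sigma> [2..int n]). \<exists>a. b = gap_at m a"
      using gap_at_surj by blast
    then obtain u where "map \<sigma> [2..int n] = map (gap_at m) u"
      unfolding ex_map_conv[symmetric] by blast
    then have u: "?w = prefix_neg u" using L by (simp add: w_Cons prefix_neg_def)
    have "u \<in> simsun_words n'"
      using simsun_words_prefix_neg_iff[of n' u] L w \<open>m \<le> n\<close> unfolding u unfolding n by blast
    moreover from this have "word_gae n' u < m"
      using word_gae_prefix_neg_less_iff[OF simsun_signed] L \<open>m \<le> n\<close> unfolding u unfolding n by blast
    ultimately show ?R using u \<open>m \<le> n\<close> by blast
  next
    assume ?R
    then obtain u where u: "?w = prefix_neg u" "m \<le> n" "u \<in> simsun_words n'" "word_gae n' u < m"
      by blast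
    have "\<sigma> 1 = - int m" using u(1) by (simp add: w_Cons prefix_neg_def)
    then show ?L
      using simsun_words_prefix_neg_iff[of n' u] word_gae_prefix_neg_less_iff[OF simsun_signed[OF u(3)]] u
      unfolding u(1) unfolding n by blast
  qed
  finally show ?thesis using True by simp
qed (simp add: RSII_D_first_def RSII_D_def RSII_iff)

lemma RSII_D_first_sum:
  assumes n: "n = Suc n'" and "m \<le> n"
  shows "(\<Sum>\<sigma>\<in>RSII_D_first n (- int m). F (nva n \<sigma>)) = simsun_sum n' (\<lambda>g. g < m) (\<lambda>a b c. F a)"
proof -
  let ?W = "{w \<in> simsun_words n'. word_gae n' w < m}"
  have inj: "inj_on prefix_neg ?W"
    using inj_gap_at by (auto simp: prefix_neg_def inj_on_def)
  have "{y \<in> signed_words n. \<exists>w. y = prefix_neg w \<and> m \<le> n \<and> w \<in> simsun_words n' \<and> word_gae n' w < m}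
      = prefix_neg ` ?W"
    using assms signed_words_prefix_neg_iff[of n'] simsun_signed by (auto simp: n)
  moreover have "RSII_D_first n (- int m) = {\<sigma> \<in> signed_perms n.
      \<exists>w. word n \<sigma> = prefix_neg w \<and> m \<le> n \<and> w \<in> simsun_words n' \<and> word_gae n' w < m}"
    using RSII_D_first_iff[OF n] by blast
  ultimately have "bij_betw (word n) (RSII_D_first n (- int m)) (prefix_neg ` ?W)"
    using bij_betw_filter[OF bij_betw_word[of n], of
        "\<lambda>y. \<exists>w. y = prefix_neg w \<and> m \<le> n \<and> w \<in> simsun_words n' \<and> word_gae n' w < m"]
    by simp
  then have "(\<Sum>\<sigma>\<in>RSII_D_first n (- int m). F (nva n \<sigma>)) =
      (\<Sum>w\<in>prefix_neg ` ?W. F (card (adj outward w)))"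
    unfolding nva_eq by (rule sum.reindex_bij_betw)
  also have "\<dots> = (\<Sum>w\<in>?W. F (card (adj outward w)))"
    using inj by (auto simp: sum.reindex card_outward_prefix_neg intro!: sum.cong)
  finally show ?thesis by (simp add: simsun_sum_def weight_def Let_def)
qed

end

section \<open>Comparison with the recurrences for V\<close>

text \<open>
  The powers of \<open>t\<close> as an opaque constant, which keeps the simplifier from turning products with
  them into shifts of Laurent series.
\<close>

definition monom_t :: "int \<Rightarrow> int fls" where
  "monom_t i = fls_X_intpow i"

lemma monom_t_simps:
  "monom_t i * monom_t j = monom_t (i + j)" "monom_t i ^ m = monom_t (int m * i)" "monom_t 0 = 1"
  "fls_X = monom_t 1" "fls_X_inv = monom_t (- 1)"
  by (simp_all add: monom_t_def fls_X_intpow_times_fls_X_intpow fls_X_intpow_power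
      fls_X_conv_shift_1 fls_X_inv_conv_shift_1)

lemma monom_t_mult_left: "monom_t i * (monom_t j * f) = monom_t (i + j) * f"
  by (simp add: monom_t_simps flip: mult.assoc)

abbreviation (input) "outward_weighting \<equiv> \<lambda>a (b::nat) (c::nat). monom_t (- 2) ^ a"

text \<open>
  Evaluation at \<open>u = t\<^sup>-\<^sup>2\<close>, \<open>v = w = 1\<close>, where \<open>u + v - w\<^sup>2 = t\<^sup>-\<^sup>2\<close>.
\<close>

lemma conserves_outward: "conserves (monom_t (- 2)) outward_weighting"
  by (simp add: conserves_def)

definition B_sum :: "nat \<Rightarrow> nat \<Rightarrow> int fls" where
  "B_sum n g = monom_t (int n + 1) * simsun_sum n (\<lambda>h. h = g) outward_weighting"

text \<open>
  By the bijection that removes the first letter, this is the sum over the elements of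
  \<open>RSII_D n\<close> with first letter \<open>-m\<close> if \<open>1 \<le> m \<le> n\<close>. In contrast to \<open>B_sum (n - 1)\<close> it also makes sense for
  \<open>n = 1\<close>, where the empty word accounts for the initial value \<open>V 1 (-1) = 1\<close>.
\<close>

definition D_sum :: "nat \<Rightarrow> nat \<Rightarrow> int fls" where
  "D_sum n m = monom_t (int n - 1) * simsun_sum (n - 1) (\<lambda>h. h < m) outward_weighting"

lemma simsun_sum_scale: "simsun_sum n Q (\<lambda>a b c. r * \<phi> a b c) = r * simsun_sum n Q \<phi>"
  by (simp add: simsun_sum_def weight_def Let_def sum_distrib_left)

lemma weight_monom: "monom_t (e - 2 * int a) = monom_t e * monom_t (- 2) ^ a"
  by (simp add: monom_t_simps mult.commute)

lemma B_sum_eq: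
  "(\<Sum>\<sigma>\<in>RSII_B_gae n g. fls_X_intpow (int n + 1 - 2 * int (nva n \<sigma>))) = B_sum n g"
  using RSII_B_gae_sum[of "\<lambda>a. monom_t (int n + 1 - 2 * int a)" n g]
  unfolding B_sum_def monom_t_def[symmetric] weight_monom simsun_sum_scale .

lemma D_sum_eq:
  assumes "1 \<le> m" "m \<le> n"
  shows "(\<Sum>\<sigma>\<in>RSII_D_first n (- int m). fls_X_intpow (int n - 1 - 2 * int (nva n \<sigma>))) = D_sum n m"
  using RSII_D_first_sum[of m n "n - 1" "\<lambda>a. monom_t (int n - 1 - 2 * int a)"] assms
  unfolding D_sum_def monom_t_def[symmetric] weight_monom simsun_sum_scale by simp

lemma simsun_words_0: "simsun_words 0 = {[]}"
  by (auto simp: simsun_words_def signed_words_def admissible_def restr_def has_double_descent_def)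

lemma simsun_sum_0: "Q 0 \<Longrightarrow> simsun_sum 0 Q \<phi> = \<phi> 0 0 0"
  by (simp add: simsun_sum_def simsun_words_0 word_gae_def weight_def Let_def)

lemma B_sum_1: "B_sum 1 1 = monom_t 2"
  using simsun_sum_eq[of 0 1 outward_weighting] by (simp add: B_sum_def simsun_sum_0 append_op_def)

lemma D_sum_1: "D_sum 1 1 = 1"
  by (simp add: D_sum_def simsun_sum_0 monom_t_simps)

text \<open>
  The sum is empty: a nonempty word all of whose restrictions start with a positive letter
  restricts to the word \<open>1\<close>, so \<open>1\<close> is augmenting. In terms of monomials, the derivative of the
  monomial \<open>1\<close> of the empty word is \<open>0\<close>.
\<close>

lemma D_sum_first:
  assumes "2 \<le> n"
  shows "D_sum n 1 = 0"
proof -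
  obtain l where n: "n = Suc (Suc l)" using assms by (metis Suc_le_D numeral_2_eq_2 Suc_le_mono)
  have "simsun_sum (Suc l) (\<lambda>h. h < 1) outward_weighting = (insert_op ^^ Suc l) outward_weighting 0 0 0"
    using simsun_sum_le[of 0 "Suc l" outward_weighting] by (simp add: simsun_sum_0)
  then show ?thesis by (simp add: n D_sum_def insert_op_def)
qed

lemma D_sum_Suc:
  assumes "2 \<le> n"
  shows "D_sum n (Suc m) = D_sum n m + monom_t (- 1) * B_sum (n - 1) m"
proof -
  have "simsun_sum (n - 1) (\<lambda>h. h < Suc m) \<phi> = simsun_sum (n - 1) (\<lambda>h. h < m) \<phi> + simsun_sum (n - 1) (\<lambda>h. h = m) \<phi>"
    for \<phi> :: "int fls weighting"
  proof -
    have "{w \<in> simsun_words (n - 1). word_gae (n - 1) w < Suc m} =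
        {w \<in> simsun_words (n - 1). word_gae (n - 1) w < m} \<union> {w \<in> simsun_words (n - 1). word_gae (n - 1) w = m}"
      by auto
    then show ?thesis unfolding simsun_sum_def
      using finite_simsun_words by (simp only:) (rule sum.union_disjoint; auto)
  qed
  then show ?thesis
    using assms by (simp add: D_sum_def B_sum_def monom_t_mult_left distrib_left of_nat_diff)
qed

text \<open>
  The last letter \<open>n\<close> can be removed without changing any descent, so both sides are sums over
  all words of size \<open>n - 1\<close>.
\<close>

lemma B_sum_last:
  assumes "2 \<le> n"
  shows "B_sum n n = monom_t 2 * D_sum n n"
proof -
  have "simsun_sum n (\<lambda>h. h = n) outward_weighting = simsun_sum (n - 1) (\<lambda>_. True) (append_op outward_weighting)"
    using simsun_sum_eq[of "n - 1" n outward_weighting] assms by simp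
  also have "append_op outward_weighting = outward_weighting"
    by (intro ext) (simp add: append_op_def)
  also have "simsun_sum (n - 1) (\<lambda>_. True) outward_weighting = simsun_sum (n - 1) (\<lambda>h. h < n) outward_weighting"
    using le_less_trans[OF word_gae_le, of "n - 1" n] assms by (intro simsun_sum_cong) auto
  finally show ?thesis by (simp add: B_sum_def D_sum_def monom_t_mult_left add.commute)
qed

lemma B_sum_step:
  assumes "1 \<le> g" "g < n"
  shows "B_sum n g = B_sum n (Suc g) + monom_t 1 * D_sum (n - 1) g"
proof -
  have "simsun_sum (n - 2) (\<lambda>h. h \<le> g - 1) outward_weighting = simsun_sum (n - 2) (\<lambda>h. h < g) outward_weighting"
    using assms by (intro simsun_sum_cong) auto
  then show ?thesis
    using simsun_sum_recurrence[OF conserves_outward assms] assms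
    by (simp add: D_sum_def B_sum_def monom_t_mult_left distrib_left of_nat_diff numeral_2_eq_2)
qed

text \<open>
  For fixed \<open>n\<close> the recurrences run from \<open>V n (-n)\<close> up to \<open>V n (-1)\<close>, on to \<open>V n 1\<close> and then up to
  \<open>V n n\<close>; the values for \<open>n - 1\<close> enter as increments.
\<close>

lemma V_eq_sums:
  assumes "1 \<le> k" "k \<le> n"
  shows "V n (int k) = B_sum n (n - k + 1) \<and> V n (- int k) = D_sum n (n - k + 1)"
  using assms
proof (induction n arbitrary: k rule: less_induct)
  case (less n)
  show ?case
  proof (cases "n = 1")
    case True
    then have "k = 1" using less.prems by simp
    then show ?thesis using V_recurrences(1,2) True B_sum_1 D_sum_1
      by (simp add: monom_t_simps)
  next
    case False
    then have n: "2 \<le> n" using less.prems by simp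
    have IH: "V (n - 1) (int j) = B_sum (n - 1) (n - j)" "V (n - 1) (- int j) = D_sum (n - 1) (n - j)"
      if "1 \<le> j" "j < n" for j
      using less.IH[of "n - 1" j] that n by (simp_all add: Suc_diff_le[symmetric])
    have neg: "V n (- int k) = D_sum n (n - k + 1)" if "1 \<le> k" "k \<le> n" for k
      using that(2,1)
    proof (induction k rule: inc_induct)
      case base
      then show ?case using V_recurrences(3)[OF n] D_sum_first[OF n] by simp
    next
      case (step j)
      have "V n (- int j) = V n (- int j - 1) + fls_X_inv * V (n - 1) (int j)"
        using step by (intro V_recurrences(4)) auto
      also have "- int j - 1 = - int (Suc j)" by simp
      also have "V n (- int (Suc j)) = D_sum n (n - j)"
        using step by (simp add: Suc_diff_Suc)
      also have "V (n - 1) (int j) = B_sum (n - 1) (n - j)" using IH(1) step by simp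
      finally show ?case using D_sum_Suc[OF n, of "n - j"] by (simp add: monom_t_simps)
    qed
    have "V n (int k) = B_sum n (n - k + 1)" if "1 \<le> k" "k \<le> n" for k
      using that
    proof (induction k rule: dec_induct)
      case base
      then show ?case
        using V_recurrences(5)[OF n] neg[of 1] n B_sum_last[OF n] by (simp add: monom_t_simps)
    next
      case (step j)
      have "V n (int (Suc j)) = V n (int (Suc j) - 1) + fls_X * V (n - 1) (- int (Suc j) + 1)"
        using step by (intro V_recurrences(6)) auto
      also have "V n (int (Suc j) - 1) = B_sum n (Suc (n - j))" using step by simp
      also have "V (n - 1) (- int (Suc j) + 1) = D_sum (n - 1) (n - j)" using IH(2)[of j] step by simp
      finally show ?case
        using B_sum_step[of "n - j" n] step by (simp add: monom_t_simps Suc_diff_Suc)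
    qed
    then show ?thesis using neg less.prems by blast
  qed
qed

theorem theorem2p14:
  fixes n k :: nat
  assumes "1 \<le> k" and "k \<le> n"
  shows "V n (int k) =
           (\<Sum>\<sigma>\<in>RSII_B_gae n (n - k + 1). fls_X_intpow (int n + 1 - 2 * int (nva n \<sigma>)))
       \<and> V n (- int k) =
           (\<Sum>\<sigma>\<in>RSII_D_first n (- int n + int k - 1). fls_X_intpow (int n - 1 - 2 * int (nva n \<sigma>)))"
proof -
  have "- int n + int k - 1 = - int (n - k + 1)" using assms by simp
  then show ?thesis
    using V_eq_sums[OF assms] B_sum_eq D_sum_eq[of "n - k + 1" n] assms by simp
qed

end
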